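(* Let $P$ be a lower graded, locally Eulerian poset and let $\sigma:Q\to P$ be a formal subdivision of $P$. (a) The function $f:P\to\mathbb K[x]$ defined by $f_u(x)=h(Q_u,x)$ is $\lambda$-acceptable (with respect to $P$). (b) Assume $P$ has a maximum element $\hat1$, let $d=\rho(\hat1)$, let $\xi=\xi(P,\lambda)$, and define $\ell_P(Q,x)=\sum_{u\in P}h(Q_u,x)\,\xi^{-1}_{u\hat1}(x)$, where $\xi^{-1}$ is the inverse of $\xi$ in $I(P)$. Then $x^d\,\ell_P(Q,1/x)=\ell_P(Q,x)$. (c) Assume $P$ is finite and graded of rank $d$. Then $$h(Q,x)=\sum_{u\in P}\ell_{P_{\le u}}(Q_u,x)\,h(P_{\ge u},x),$$ where $\ell_{P_{\le u}}(Q_u,x)$ is defined as in (b) for the formal subdivision $\sigma|_{Q_u}:Q_u\to P_{\le u}$, and $P_{\ge u}=\{t\in P:t\ge u\}$.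
   Context: Fix a field $\mathbb K$. A poset $P$ is lower graded if each principal order ideal $P_{\le t}$ is finite and graded; $\rho(t)$ is the length of its maximal chains ($P$ need not have a minimum). $P$ is locally graded if every closed interval $[s,t]$ is finite and graded, of rank $\rho(s,t)$; it is locally Eulerian if moreover its Möbius function satisfies $\mu_P(s,t)=(-1)^{\rho(s,t)}$ for all $s\le t$. The length of a finite poset is the maximum length of a chain. Incidence algebra $I(P)$: functions $g$ on closed intervals with values $g_{st}(x)\in\mathbb K[x]$, product $(gh)_{su}=\sum_{s\le t\le u}g_{st}h_{tu}$; for $f:P\to\mathbb K[x]$, $(fg)_t=\sum_{s\le t}f_sg_{st}$. Bars: $\overline f_t(x)=x^{\rho(t)}f_t(1/x)$, $\overline g_{st}(x)=x^{\rho(s,t)}g_{st}(1/x)$. A unitary ($\kappa_{tt}=1$) $\kappa\in I(P)$ is a $P$-kernel if $\overline\kappa=\kappa^{-1}$. $f$ is $\kappa$-acceptable if $f\kappa=\overline f$; $g\in I(P)$ is $\kappa$-totally acceptable if $g\kappa=\overline g$. For $P$ locally Eulerian, $\lambda_{st}(x)=(x-1)^{\rho(s,t)}$ defines a $P$-kernel $\lambda$. For lower graded locally graded $P$ with kernel $\kappa$: $\gamma(P,\kappa):P\to\mathbb K[x]$ is the unique $\kappa$-acceptable function with $\gamma_a=1$ for minimal $a$ and $\deg\gamma_t\le\lfloor(\rho(t)-1)/2\rfloor$ when $\rho(t)\ge1$; $\xi(P,\kappa)\in I(P)$ is the unique $\kappa$-totally acceptable function with $\xi_{tt}=1$ and $\deg\xi_{st}\le\lfloor(\rho(s,t)-1)/2\rfloor$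 for $s<t$ (both exist). $h$-polynomial: for a finite, lower graded, locally Eulerian poset $R$ of length $d$, $h(R,x)$ is defined by $x^dh(R,1/x)=\sum_{t\in R}\gamma_t(x)(x-1)^{d-\rho(t)}$, $\gamma=\gamma(R,\lambda)$. A formal subdivision of $P$ is a lower graded, locally Eulerian poset $Q$ with a surjective map $\sigma:Q\to P$ such that: (i) $\rho(t)\le\rho(\sigma(t))$ for all $t\in Q$; (ii) for every $u\in P$, $Q_u:=\sigma^{-1}(P_{\le u})$ is an order ideal of $Q$ of length $\rho(u)$; (iii) for every $u\in P$ (each $Q_u$ being finite), $x^{\rho(u)}h(Q_u,1/x)=h(\mathrm{int}(Q_u),x)$, where $\mathrm{int}(Q_u)=\sigma^{-1}(u)$, $x^{\rho(u)}h(Q_u,1/x)=\sum_{t\in Q_u}\gamma_t(x)(x-1)^{\rho(u)-\rho(t)}$ and $x^{\rho(u)}h(\mathrm{int}(Q_u),1/x)=\sum_{t\in\mathrm{int}(Q_u)}\gamma_t(x)(x-1)^{\rho(u)-\rho(t)}$, with $\gamma=\gamma(Q,\lambda)$. *)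

theory Defs
  imports "HOL-Computational_Algebra.Computational_Algebra"
begin

text \<open>
  A poset is a subset \<open>P\<close> of a type of class \<^class>\<open>order\<close>, with the induced order; the type and
  the subset are arbitrary. Subposets such as \<open>P\<^sub>\<le>\<^sub>t\<close> are then just subsets.
\<close>

definition princ_ideal :: "'a::order set \<Rightarrow> 'a \<Rightarrow> 'a set" where
  "princ_ideal P t = {s \<in> P. s \<le> t}"

definition princ_filter :: "'a::order set \<Rightarrow> 'a \<Rightarrow> 'a set" where
  "princ_filter P t = {s \<in> P. t \<le> s}"

definition interval :: "'a::order set \<Rightarrow> 'a \<Rightarrow> 'a \<Rightarrow> 'a set" where
  "interval P s t = {r \<in> P. s \<le> r \<and> r \<le> t}"

definition order_ideal :: "'a::order set \<Rightarrow> 'a set \<Rightarrow> bool" where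
  "order_ideal I P \<longleftrightarrow> I \<subseteq> P \<and> (\<forall>t\<in>I. \<forall>s\<in>P. s \<le> t \<longrightarrow> s \<in> I)"

definition minimal_elt :: "'a::order set \<Rightarrow> 'a \<Rightarrow> bool" where
  "minimal_elt P a \<longleftrightarrow> a \<in> P \<and> (\<forall>s\<in>P. \<not> s < a)"

definition maximum_elt :: "'a::order set \<Rightarrow> 'a \<Rightarrow> bool" where
  "maximum_elt P m \<longleftrightarrow> m \<in> P \<and> (\<forall>s\<in>P. s \<le> m)"

text \<open>Used only for finite posets; the length of a chain with \<open>n + 1\<close> elements is \<open>n\<close>.\<close>

definition poset_length :: "'a::order set \<Rightarrow> nat" where
  "poset_length P = Max ((\<lambda>C. card C - 1) ` {C. pred_on.chain P (<) C})"

definition graded_of_rank :: "'a::order set \<Rightarrow> nat \<Rightarrow> bool" where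
  "graded_of_rank P d \<longleftrightarrow>
     finite P \<and> (\<forall>C. pred_on.maxchain P (<) C \<longrightarrow> card C - 1 = d)"

definition finite_graded :: "'a::order set \<Rightarrow> bool" where
  "finite_graded P \<longleftrightarrow> (\<exists>d. graded_of_rank P d)"

definition lower_graded :: "'a::order set \<Rightarrow> bool" where
  "lower_graded P \<longleftrightarrow> (\<forall>t\<in>P. finite_graded (princ_ideal P t))"

definition rk :: "'a::order set \<Rightarrow> 'a \<Rightarrow> nat" where
  "rk P t = poset_length (princ_ideal P t)"

definition locally_graded :: "'a::order set \<Rightarrow> bool" where
  "locally_graded P \<longleftrightarrow> (\<forall>s\<in>P. \<forall>t\<in>P. s \<le> t \<longrightarrow> finite_graded (interval P s t))"

definition rk_int :: "'a::order set \<Rightarrow> 'a \<Rightarrow> 'a \<Rightarrow> nat" where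
  "rk_int P s t = poset_length (interval P s t)"

text \<open>
  An element of the incidence algebra is a function of two arguments vanishing outside the closed
  intervals of \<open>P\<close>. The coefficient ring is arbitrary: the Moebius function must be taken with
  integer values, since \<open>\<mu>(s,t) = (-1)\<^bsup>\<rho>(s,t)\<^esup>\<close> in a field of positive
  characteristic would be a weaker condition.
\<close>

definition inc_alg :: "'a::order set \<Rightarrow> ('a \<Rightarrow> 'a \<Rightarrow> 'r::comm_ring_1) set" where
  "inc_alg P = {g. \<forall>s t. \<not> (s \<in> P \<and> t \<in> P \<and> s \<le> t) \<longrightarrow> g s t = 0}"

definition inc_mult ::
  "'a::order set \<Rightarrow> ('a \<Rightarrow> 'a \<Rightarrow> 'r::comm_ring_1) \<Rightarrow> ('a \<Rightarrow> 'a \<Rightarrow> 'r) \<Rightarrow> 'a \<Rightarrow> 'a \<Rightarrow> 'r" where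
  "inc_mult P g h s u =
     (if s \<in> P \<and> u \<in> P \<and> s \<le> u then \<Sum>t\<in>interval P s u. g s t * h t u else 0)"

definition inc_one :: "'a::order set \<Rightarrow> 'a \<Rightarrow> 'a \<Rightarrow> 'r::comm_ring_1" where
  "inc_one P s t = (if s \<in> P \<and> s = t then 1 else 0)"

definition inc_inv ::
  "'a::order set \<Rightarrow> ('a \<Rightarrow> 'a \<Rightarrow> 'r::comm_ring_1) \<Rightarrow> 'a \<Rightarrow> 'a \<Rightarrow> 'r" where
  "inc_inv P g =
     (THE h. h \<in> inc_alg P \<and> inc_mult P g h = inc_one P \<and> inc_mult P h g = inc_one P)"

definition inc_zeta :: "'a::order set \<Rightarrow> 'a \<Rightarrow> 'a \<Rightarrow> 'r::comm_ring_1" where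
  "inc_zeta P s t = (if s \<in> P \<and> t \<in> P \<and> s \<le> t then 1 else 0)"

definition moebius :: "'a::order set \<Rightarrow> 'a \<Rightarrow> 'a \<Rightarrow> int" where
  "moebius P = inc_inv P (inc_zeta P)"

definition locally_Eulerian :: "'a::order set \<Rightarrow> bool" where
  "locally_Eulerian P \<longleftrightarrow> locally_graded P \<and>
     (\<forall>s\<in>P. \<forall>t\<in>P. s \<le> t \<longrightarrow> moebius P s t = (-1) ^ rk_int P s t)"

text \<open>The element \<open>x\<^sup>n p(1/x)\<close> of \<open>K(x)\<close>; it lies in \<open>K[x]\<close> iff \<open>p = 0\<close> or \<open>deg p \<le> n\<close>.\<close>

definition bar :: "nat \<Rightarrow> 'k::field poly \<Rightarrow> 'k poly fract" where
  "bar n p = to_fract [:0, 1:] ^ n *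
     poly (map_poly (\<lambda>c. to_fract [:c:]) p) (inverse (to_fract [:0, 1:]))"

definition acceptable ::
  "'a::order set \<Rightarrow> ('a \<Rightarrow> 'a \<Rightarrow> 'k::field poly) \<Rightarrow> ('a \<Rightarrow> 'k poly) \<Rightarrow> bool" where
  "acceptable P \<kappa> f \<longleftrightarrow>
     (\<forall>t\<in>P. to_fract (\<Sum>s\<in>princ_ideal P t. f s * \<kappa> s t) = bar (rk P t) (f t))"

definition totally_acceptable ::
  "'a::order set \<Rightarrow> ('a \<Rightarrow> 'a \<Rightarrow> 'k::field poly) \<Rightarrow> ('a \<Rightarrow> 'a \<Rightarrow> 'k poly) \<Rightarrow> bool" where
  "totally_acceptable P \<kappa> g \<longleftrightarrow> g \<in> inc_alg P \<and>
     (\<forall>s\<in>P. \<forall>t\<in>P. s \<le> t \<longrightarrow> to_fract (inc_mult P g \<kappa> s t) = bar (rk_int P s t) (g s t))"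

definition lam :: "'a::order set \<Rightarrow> 'a \<Rightarrow> 'a \<Rightarrow> 'k::field poly" where
  "lam P s t = (if s \<in> P \<and> t \<in> P \<and> s \<le> t then [:-1, 1:] ^ rk_int P s t else 0)"

text \<open>Functions on \<open>P\<close> are extended by 0 to make them unique as HOL functions.\<close>

definition gam :: "'a::order set \<Rightarrow> ('a \<Rightarrow> 'a \<Rightarrow> 'k::field poly) \<Rightarrow> 'a \<Rightarrow> 'k poly" where
  "gam P \<kappa> = (THE f. (\<forall>t. t \<notin> P \<longrightarrow> f t = 0) \<and> acceptable P \<kappa> f \<and>
     (\<forall>a. minimal_elt P a \<longrightarrow> f a = 1) \<and>
     (\<forall>t\<in>P. rk P t \<ge> 1 \<longrightarrow> degree (f t) \<le> (rk P t - 1) div 2))"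

definition xi :: "'a::order set \<Rightarrow> ('a \<Rightarrow> 'a \<Rightarrow> 'k::field poly) \<Rightarrow> 'a \<Rightarrow> 'a \<Rightarrow> 'k poly" where
  "xi P \<kappa> = (THE g. totally_acceptable P \<kappa> g \<and> (\<forall>t\<in>P. g t t = 1) \<and>
     (\<forall>s\<in>P. \<forall>t\<in>P. s < t \<longrightarrow> degree (g s t) \<le> (rk_int P s t - 1) div 2))"

text \<open>
  The polynomial \<open>p\<close> with \<open>x\<^sup>d p(1/x) = \<Sum>\<^bsub>t\<in>S\<^esub> \<gamma>\<^sub>t(x) (x-1)\<^bsup>d-\<rho>(t)\<^esup>\<close>,
  where \<open>\<gamma>\<close> and \<open>\<rho>\<close> are those of \<open>R\<close> and \<open>S \<subseteq> R\<close> is finite, with \<open>\<rho> \<le> d\<close> on \<open>S\<close>.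
\<close>

definition h_part :: "nat \<Rightarrow> 'a::order set \<Rightarrow> 'a set \<Rightarrow> 'k::field poly" where
  "h_part d R S = (THE p. bar d p =
     to_fract (\<Sum>t\<in>S. gam R (lam R) t * [:-1, 1:] ^ (d - rk R t)))"

definition h_poly :: "'a::order set \<Rightarrow> 'k::field poly" where
  "h_poly R = h_part (poset_length R) R R"

definition sub_below :: "'p::order set \<Rightarrow> 'q::order set \<Rightarrow> ('q \<Rightarrow> 'p) \<Rightarrow> 'p \<Rightarrow> 'q set" where
  "sub_below P Q \<sigma> u = {t \<in> Q. \<sigma> t \<in> princ_ideal P u}"

definition sub_int :: "'q::order set \<Rightarrow> ('q \<Rightarrow> 'p::order) \<Rightarrow> 'p \<Rightarrow> 'q set" where
  "sub_int Q \<sigma> u = {t \<in> Q. \<sigma> t = u}"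

text \<open>
  The field enters only through the last condition, hence the type argument.
\<close>

definition formal_subdivision ::
  "'k::field itself \<Rightarrow> 'p::order set \<Rightarrow> 'q::order set \<Rightarrow> ('q \<Rightarrow> 'p) \<Rightarrow> bool" where
  "formal_subdivision (_ :: 'k itself) P Q \<sigma> \<longleftrightarrow>
     lower_graded Q \<and> locally_Eulerian Q \<and> \<sigma> ` Q = P \<and>
     (\<forall>t\<in>Q. rk Q t \<le> rk P (\<sigma> t)) \<and>
     (\<forall>u\<in>P. order_ideal (sub_below P Q \<sigma> u) Q \<and> finite (sub_below P Q \<sigma> u) \<and>
        poset_length (sub_below P Q \<sigma> u) = rk P u) \<and>
     (\<forall>u\<in>P. bar (rk P u) (h_poly (sub_below P Q \<sigma> u) :: 'k poly) =
        to_fract (h_part (rk P u) Q (sub_int Q \<sigma> u)))"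

definition local_h ::
  "'p::order set \<Rightarrow> 'q::order set \<Rightarrow> ('q \<Rightarrow> 'p) \<Rightarrow> 'k::field poly" where
  "local_h P Q \<sigma> = (\<Sum>u\<in>P. h_poly (sub_below P Q \<sigma> u) *
     inc_inv P (xi P (lam P)) u (THE m. maximum_elt P m))"

end

theory Submission
  imports Defs
begin

text \<open>
  Condition (iii), reflected, says that \<open>h(Q\<^sub>u, x)\<close> is the sum of \<open>\<gamma>\<^sub>t (x - 1)\<^bsup>\<rho>(u) - \<rho>(t)\<^esup>\<close> over
  the \<open>t\<close> with \<open>\<sigma> t = u\<close>. Regrouping the sum over \<open>Q\<^sub>u\<close> that defines the reflected polynomial by
  the values of \<open>\<sigma>\<close> therefore gives (a). Expand an acceptable function as
  \<open>f\<^sub>u = \<Sum>\<^bsub>v \<le> u\<^esub> \<ell>\<^sub>v \<xi>\<^bsub>vu\<^esub>\<close>; reflecting this and comparing with \<open>f \<lambda>\<close>, using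
  \<open>\<xi> \<lambda> = bar \<xi>\<close>, yields the symmetry of \<open>\<ell>\<^sub>u\<close> by induction on \<open>u\<close>, which is (b). For (c), group
  the sum for \<open>h(Q, x)\<close> by \<open>\<sigma>\<close>, insert this expansion, and note that \<open>\<xi>\<^bsub>v\<cdot>\<^esub>\<close> is the
  \<open>\<gamma>\<close>-function of \<open>P\<^sub>\<ge>\<^sub>v\<close>.

  Existence of \<open>\<gamma>\<close> is proved over the integers and transported to the field, because an
  antisymmetric polynomial may have a nonzero middle coefficient in characteristic 2.
\<close>

section \<open>Reflection of polynomials\<close>

text \<open>This is x^n p(1/x) as long as \<open>degree p\<close> is at most \<open>n\<close>.
  Coefficients beyond \<open>n\<close> are lost, so degree bounds accompany the involution and
  multiplicativity laws. Unlike \<open>bar\<close>, it makes sense over the integers.\<close>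

definition reflect_to :: "nat \<Rightarrow> 'a::comm_ring_1 poly \<Rightarrow> 'a poly" where
  "reflect_to n p = (\<Sum>i\<le>n. monom (coeff p (n - i)) i)"

lemma coeff_reflect_to: "coeff (reflect_to n p) i = (if i \<le> n then coeff p (n - i) else 0)"
  by (simp add: reflect_to_def coeff_sum)

lemma degree_reflect_to: "degree (reflect_to n p) \<le> n"
  by (rule degree_le) (simp add: coeff_reflect_to)

lemma reflect_to_involution:
  assumes "degree p \<le> n"
  shows "reflect_to n (reflect_to n p) = p"
  using assms by (intro poly_eqI) (auto simp: coeff_reflect_to intro: coeff_eq_0)

lemma reflect_to_add: "reflect_to n (p + q) = reflect_to n p + reflect_to n q"
  by (intro poly_eqI) (auto simp: coeff_reflect_to)

lemma reflect_to_0 [simp]: "reflect_to n 0 = 0"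
  by (simp add: reflect_to_def)

lemma reflect_to_sum: "reflect_to n (sum f A) = (\<Sum>a\<in>A. reflect_to n (f a))"
  by (induction A rule: infinite_finite_induct) (simp_all add: reflect_to_add)

lemma reflect_to_eq_reflect_poly:
  assumes "degree p \<le> n"
  shows "reflect_to n p = monom 1 (n - degree p) * reflect_poly p"
proof (intro poly_eqI)
  fix i
  show "coeff (reflect_to n p) i = coeff (monom 1 (n - degree p) * reflect_poly p) i"
    using assms by (auto simp: coeff_reflect_to coeff_monom_mult coeff_reflect_poly intro: coeff_eq_0)
qed

text \<open>Reduces to multiplicativity of \<open>reflect_poly\<close>: the gap between nominal and
  true degree becomes a power of x, and gaps add. Degrees add only for nonzero factors, hence the
  case split.\<close>

lemma reflect_to_mult:
  fixes p q :: "'a::idom poly"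
  assumes "degree p \<le> m" and "degree q \<le> n"
  shows "reflect_to (m + n) (p * q) = reflect_to m p * reflect_to n q"
proof (cases "p = 0 \<or> q = 0")
  case False
  then have deg: "degree (p * q) = degree p + degree q"
    by (simp add: degree_mult_eq)
  then have "reflect_to (m + n) (p * q) =
      monom 1 ((m - degree p) + (n - degree q)) * (reflect_poly p * reflect_poly q)"
    using assms by (simp add: reflect_to_eq_reflect_poly reflect_poly_mult)
  also have "\<dots> = reflect_to m p * reflect_to n q"
    using assms mult_monom[of "1::'a" "m - degree p" 1 "n - degree q"]
    by (simp add: reflect_to_eq_reflect_poly algebra_simps)
  finally show ?thesis .
qed auto

lemma reflect_to_one: "reflect_to 0 1 = 1"
  by (simp add: reflect_to_def)

lemma degree_linear_power: "degree ([:-1, 1:] ^ n :: 'a::idom poly) = n"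
  by (simp add: degree_power_eq)

lemma reflect_to_linear_power:
  "reflect_to n ([:-1, 1:] ^ n :: 'a::idom poly) = [:1, -1:] ^ n"
proof (induction n)
  case 0
  then show ?case by (simp add: reflect_to_one)
next
  case (Suc n)
  have "reflect_to (1 + n) ([:-1, 1:] * [:-1, 1:] ^ n :: 'a poly) =
      reflect_to 1 [:-1, 1:] * reflect_to n ([:-1, 1:] ^ n)"
    by (rule reflect_to_mult) (simp_all add: degree_linear_power)
  moreover have "reflect_to 1 [:-1, 1:] = ([:1, -1:] :: 'a poly)"
    by (simp add: reflect_to_def monom_0 monom_Suc numeral_eq_Suc)
  ultimately show ?case using Suc by simp
qed

section \<open>The bar operation as polynomial reflection\<close>

lemma sum_atMost_flip:
  fixes g :: "nat \<Rightarrow> nat \<Rightarrow> 'b::comm_monoid_add"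
  shows "(\<Sum>i\<le>n. g i (n - i)) = (\<Sum>i\<le>n. g (n - i) i)"
  by (rule sum.reindex_bij_witness[of _ "\<lambda>i. n - i" "\<lambda>i. n - i"]) auto

text \<open>The computation behind \<open>bar_eq_reflect_to\<close>, where \<open>X\<close> is the
  indeterminate in K(x). Padding with zero coefficients lets \<open>n\<close> exceed the
  degree.\<close>

lemma power_times_sum_inverse_powers:
  fixes X :: "'f::field" and c :: "nat \<Rightarrow> 'f"
  assumes "X \<noteq> 0" and "d \<le> n" and c0: "\<And>i. i > d \<Longrightarrow> c i = 0"
  shows "X ^ n * (\<Sum>i\<le>d. c i * inverse X ^ i) = (\<Sum>i\<le>n. c (n - i) * X ^ i)"
proof -
  have "X ^ n * (\<Sum>i\<le>d. c i * inverse X ^ i) = (\<Sum>i\<le>d. c i * X ^ (n - i))"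
    unfolding sum_distrib_left
    using assms by (intro sum.cong) (auto simp: power_diff field_simps)
  also have "\<dots> = (\<Sum>i\<le>n. c i * X ^ (n - i))"
    using assms by (intro sum.mono_neutral_left) auto
  also have "\<dots> = (\<Sum>i\<le>n. c (n - i) * X ^ i)"
    by (rule sum_atMost_flip)
  finally show ?thesis .
qed

lemma to_fract_monom:
  fixes c :: "'k::field"
  shows "to_fract (monom c i) = to_fract [:c:] * to_fract [:0, 1:] ^ i"
proof (induction i)
  case (Suc i)
  have "to_fract (monom c (Suc i)) = to_fract ([:0, 1:] * monom c i)"
    by (simp only: monom_Suc mult_pCons_left smult_0_left add_0_left smult_1_left) simp
  then show ?case by (simp only: to_fract_mult Suc power_Suc mult_ac)
qed (simp add: monom_0)

lemma bar_eq_reflect_to: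
  fixes p :: "'k::field poly"
  assumes "degree p \<le> n"
  shows "bar n p = to_fract (reflect_to n p)"
proof -
  let ?X = "to_fract [:0, 1 :: 'k:]"
  have deg: "degree (map_poly (\<lambda>c. to_fract [:c:]) p) = degree p"
    by (rule degree_map_poly) auto
  have coeff: "coeff (map_poly (\<lambda>c. to_fract [:c:]) p) i = to_fract [:coeff p i:]" for i
    by (simp add: coeff_map_poly)
  have "?X ^ n * (\<Sum>i\<le>degree p. to_fract [:coeff p i:] * inverse ?X ^ i) =
      (\<Sum>i\<le>n. to_fract [:coeff p (n - i):] * ?X ^ i)"
  proof (rule power_times_sum_inverse_powers[where c = "\<lambda>i. to_fract [:coeff p i:]"])
    show "?X \<noteq> 0" by simp
  qed (use assms in \<open>simp_all add: coeff_eq_0\<close>)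
  then show ?thesis
    unfolding bar_def poly_altdef deg coeff reflect_to_def to_fract_sum to_fract_monom .
qed

text \<open>Raising \<open>n\<close> multiplies \<open>bar\<close> by a power of x, so
  \<open>n\<close> may be moved beyond both degrees, where \<open>bar\<close> is an involutive
  reflection. The absence of a degree bound matches the description in
  \<open>h_part\<close>.\<close>

lemma bar_inject:
  fixes p q :: "'k::field poly"
  assumes "bar n p = bar n q"
  shows "p = q"
proof -
  define N where "N = n + degree p + degree q"
  have "bar N r = to_fract [:0, 1:] ^ (N - n) * bar n r" for r :: "'k poly"
    by (simp add: bar_def N_def power_add mult_ac)
  then have "bar N p = bar N q" using assms by simp
  then have "reflect_to N p = reflect_to N q"
    by (simp add: bar_eq_reflect_to N_def)
  then have "reflect_to N (reflect_to N p) = reflect_to N (reflect_to N q)" by simp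
  then show ?thesis by (simp add: reflect_to_involution N_def)
qed

text \<open>The lower half of \<open>- w\<close> serves as \<open>r\<close>: it cancels the lower
  half of \<open>w\<close>, and its reflection supplies the upper half. This is how each new value
  of gamma is found.\<close>

lemma antisymmetric_poly_decomposition:
  fixes w :: "int poly"
  assumes "n \<ge> 1" and "degree w \<le> n" and w: "reflect_to n w = - w"
  obtains r where "degree r \<le> (n - 1) div 2" and "reflect_to n r = r + w"
proof
  let ?r = "poly_cutoff (Suc ((n - 1) div 2)) (- w)"
  show "degree ?r \<le> (n - 1) div 2"
    by (rule degree_le) (simp add: coeff_poly_cutoff)
  have w_eq: "coeff w (n - i) = - coeff w i" if "i \<le> n" for i
    using arg_cong[OF w, of "\<lambda>p. coeff p i"] that by (simp add: coeff_reflect_to)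
  show "reflect_to n ?r = ?r + w"
  proof (intro poly_eqI)
    fix i
    consider "i > n" | "i \<le> n" "2 * i = n" | "i \<le> n" "2 * i < n" | "i \<le> n" "2 * i > n" by linarith
    then show "coeff (reflect_to n ?r) i = coeff (?r + w) i"
    proof cases
      case 1
      then show ?thesis using assms by (simp add: coeff_reflect_to coeff_poly_cutoff coeff_eq_0)
    next
      case 2
      \<comment> \<open>The middle index of an even \<open>n\<close>: over the integers this
        coefficient must vanish, in characteristic 2 it need not.\<close>
      then have "coeff w i = - coeff w i" using w_eq[of i] by auto
      with 2 show ?thesis using assms(1) by (auto simp: coeff_reflect_to coeff_poly_cutoff)
    next
      case 3
      then have "i < Suc ((n - 1) div 2)" "\<not> n - i < Suc ((n - 1) div 2)" by linarith+
      with 3 show ?thesis by (simp add: coeff_reflect_to coeff_poly_cutoff)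
    next
      case 4
      then have "\<not> i < Suc ((n - 1) div 2)" "n - i < Suc ((n - 1) div 2)" by linarith+
      with 4 show ?thesis by (simp add: coeff_reflect_to coeff_poly_cutoff w_eq)
    qed
  qed
qed

text \<open>For \<open>i\<close> at most \<open>(n - 1) div 2\<close> the index \<open>n - i\<close>
  lies above that bound, so the difference shows the negated coefficient at \<open>i\<close>
  undisturbed. This is the uniqueness half of the construction of gamma.\<close>

lemma low_degree_determined_by_antisymmetrization:
  fixes p q :: "'a::comm_ring_1 poly"
  assumes "n \<ge> 1" and p: "degree p \<le> (n - 1) div 2" and q: "degree q \<le> (n - 1) div 2"
    and eq: "reflect_to n p - p = reflect_to n q - q"
  shows "p = q"
proof (intro poly_eqI)
  fix i
  show "coeff p i = coeff q i"
  proof (cases "i \<le> (n - 1) div 2")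
    case True
    then have "n - i > (n - 1) div 2" using assms(1) by linarith
    then have "coeff p (n - i) = 0" "coeff q (n - i) = 0"
      using p q by (auto intro: coeff_eq_0)
    then show ?thesis
      using arg_cong[OF eq, of "\<lambda>p. coeff p i"] by (simp add: coeff_reflect_to split: if_splits)
  next
    case False
    then show ?thesis using p q by (simp add: coeff_eq_0)
  qed
qed

section \<open>Passage from integer to field coefficients\<close>

lemma map_poly_of_int_mult:
  "map_poly of_int (p * q) = map_poly of_int p * (map_poly of_int q :: 'a::comm_ring_1 poly)"
  by (intro poly_eqI) (simp add: coeff_map_poly coeff_mult)

lemma map_poly_of_int_power:
  "map_poly of_int (p ^ n) = (map_poly of_int p :: 'a::comm_ring_1 poly) ^ n"
  by (induction n) (simp_all add: map_poly_of_int_mult map_poly_1)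

lemma map_poly_of_int_sum:
  "map_poly of_int (sum f A) = (\<Sum>a\<in>A. map_poly of_int (f a) :: 'a::comm_ring_1 poly)"
  by (intro poly_eqI) (simp add: coeff_map_poly coeff_sum)

lemma map_poly_of_int_reflect_to:
  "map_poly of_int (reflect_to n p) = reflect_to n (map_poly of_int p :: 'a::comm_ring_1 poly)"
  by (intro poly_eqI) (simp add: coeff_map_poly coeff_reflect_to)

section \<open>Graded posets\<close>

text \<open>\<open>pred_on.chain\<close> uses the reflexive closure of its relation, so chains for
  \<open><\<close> are the usual ones.\<close>

lemma less_chain_iff:
  "pred_on.chain A (<) C \<longleftrightarrow> C \<subseteq> (A :: 'a::order set) \<and> (\<forall>x\<in>C. \<forall>y\<in>C. x \<le> y \<or> y \<le> x)"
  by (auto simp: pred_on.chain_def order.order_iff_strict)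

lemma finite_chains: "finite A \<Longrightarrow> finite {C. pred_on.chain (A :: 'a::order set) (<) C}"
  by (rule finite_subset[of _ "Pow A"]) (auto simp: less_chain_iff)

lemma poset_length_ge:
  assumes "finite A" and "pred_on.chain A (<) C"
  shows "card C - 1 \<le> poset_length A"
  unfolding poset_length_def using assms by (intro Max_ge) (auto simp: finite_chains)

lemma poset_length_le:
  assumes "finite A" and "\<And>C. pred_on.chain A (<) C \<Longrightarrow> card C - 1 \<le> n"
  shows "poset_length A \<le> n"
  unfolding poset_length_def using assms
  \<comment> \<open>The empty chain shows that the maximum is taken over a nonempty set.\<close>
  by (subst Max_le_iff) (auto simp: finite_chains intro!: exI[of _ "{}"] pred_on.chain_empty)

lemma poset_length_mono:
  assumes "finite B" and "A \<subseteq> B"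
  shows "poset_length A \<le> poset_length B"
  using assms by (intro poset_length_le poset_length_ge) (auto simp: less_chain_iff intro: finite_subset)

lemma chain_subset_maxchain:
  fixes A :: "'a::order set"
  assumes "finite A" and "pred_on.chain A (<) C"
  obtains M where "pred_on.maxchain A (<) M" and "C \<subseteq> M"
proof -
  have "finite {C'. pred_on.chain A (<) C' \<and> C \<subseteq> C'}"
    by (rule finite_subset[OF _ finite_chains[OF assms(1)]]) auto
  moreover have "C \<in> {C'. pred_on.chain A (<) C' \<and> C \<subseteq> C'}" using assms by simp
  ultimately obtain M where M: "M \<in> {C'. pred_on.chain A (<) C' \<and> C \<subseteq> C'}"
    and max: "\<forall>C'\<in>{C'. pred_on.chain A (<) C' \<and> C \<subseteq> C'}. M \<subseteq> C' \<longrightarrow> M = C'"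
    using finite_has_maximal[of "{C'. pred_on.chain A (<) C' \<and> C \<subseteq> C'}"] by blast
  then have "pred_on.maxchain A (<) M"
    by (auto simp: pred_on.maxchain_def)
  with M show thesis by (intro that) auto
qed

text \<open>Every chain extends to a maximal one, so the greatest length is attained on maximal
  chains, all of which have length \<open>d\<close>.\<close>

lemma graded_poset_length:
  assumes "graded_of_rank A d"
  shows "poset_length A = d"
proof (rule antisym)
  have fin: "finite A" using assms by (simp add: graded_of_rank_def)
  show "poset_length A \<le> d"
  proof (rule poset_length_le[OF fin])
    fix C assume C: "pred_on.chain A (<) C"
    obtain M where M: "pred_on.maxchain A (<) M" "C \<subseteq> M"
      using chain_subset_maxchain[OF fin C] .
    then have "finite M"
      using fin by (meson finite_subset less_chain_iff pred_on.maxchain_imp_chain)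
    then have "card C \<le> card M" using M by (simp add: card_mono)
    then show "card C - 1 \<le> d" using assms M by (force simp: graded_of_rank_def)
  qed
  obtain M where "pred_on.maxchain A (<) M"
    using chain_subset_maxchain[OF fin pred_on.chain_empty] .
  then show "d \<le> poset_length A"
    using poset_length_ge[OF fin] assms
    by (metis graded_of_rank_def pred_on.maxchain_imp_chain)
qed

lemma finite_graded_iff: "finite_graded A \<longleftrightarrow> graded_of_rank A (poset_length A)"
  using graded_poset_length by (auto simp: finite_graded_def)

lemma maxchain_mem_comparable:
  fixes A :: "'a::order set"
  assumes "pred_on.maxchain A (<) C" and "x \<in> A" and "\<forall>y\<in>C. x \<le> y \<or> y \<le> x"
  shows "x \<in> C"
proof (rule ccontr)
  assume "x \<notin> C"
  moreover have "pred_on.chain A (<) (insert x C)"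
    using assms by (auto simp: pred_on.maxchain_def less_chain_iff)
  ultimately show False
    using assms(1) by (auto simp: pred_on.maxchain_def)
qed

text \<open>Maximality of a chain can be tested by adjoining single elements, a form suited to
  gluing chains.\<close>

lemma maxchain_iff:
  "pred_on.maxchain A (<) C \<longleftrightarrow> C \<subseteq> (A :: 'a::order set) \<and> (\<forall>x\<in>C. \<forall>y\<in>C. x \<le> y \<or> y \<le> x) \<and>
     (\<forall>x\<in>A. (\<forall>y\<in>C. x \<le> y \<or> y \<le> x) \<longrightarrow> x \<in> C)"
  (is "?L \<longleftrightarrow> ?R")
proof
  assume ?L
  then show ?R
    using maxchain_mem_comparable[of A C] by (auto simp: pred_on.maxchain_def less_chain_iff)
next
  assume ?R
  then show ?L
    unfolding pred_on.maxchain_def less_chain_iff by blast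
qed

text \<open>Everything in \<open>C\<close> lies below \<open>v\<close> and everything in
  \<open>D\<close> above it, so the union is a chain. An element comparable with all of it is
  comparable with \<open>v\<close>, and maximality of one of the two halves applies.\<close>

lemma maxchain_Un:
  fixes v :: "'a::order"
  assumes "v \<in> A" and C: "pred_on.maxchain {x \<in> A. x \<le> v} (<) C"
    and D: "pred_on.maxchain {x \<in> A. v \<le> x} (<) D" and "finite A"
  shows "pred_on.maxchain A (<) (C \<union> D)"
    and "card (C \<union> D) - 1 = (card C - 1) + (card D - 1)"
proof -
  have v: "v \<in> C" "v \<in> D" using C D assms(1) by (auto simp: maxchain_iff)
  show "pred_on.maxchain A (<) (C \<union> D)"
    unfolding maxchain_iff
  proof (intro conjI ballI impI)
    show "C \<union> D \<subseteq> A" using C D by (auto simp: maxchain_iff)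
  next
    fix x y assume "x \<in> C \<union> D" "y \<in> C \<union> D"
    moreover have "c \<le> d" if "c \<in> C" "d \<in> D" for c d
      using that C D order_trans[of c v d] by (auto simp: maxchain_iff)
    moreover have "x \<le> y \<or> y \<le> x" if "x \<in> C" "y \<in> C" for x y
      using that C by (auto simp: maxchain_iff)
    moreover have "x \<le> y \<or> y \<le> x" if "x \<in> D" "y \<in> D" for x y
      using that D by (auto simp: maxchain_iff)
    ultimately show "x \<le> y \<or> y \<le> x" by blast
  next
    fix x assume x: "x \<in> A" "\<forall>y\<in>C \<union> D. x \<le> y \<or> y \<le> x"
    then have "x \<le> v \<or> v \<le> x" using v by auto
    then show "x \<in> C \<union> D" using x C D by (auto simp: maxchain_iff)
  qed
  have fin: "finite C" "finite D"
    using C D \<open>finite A\<close> by (auto simp: maxchain_iff intro: finite_subset)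
  have "C \<subseteq> {..v}" "D \<subseteq> {v..}" using C D by (auto simp: maxchain_iff)
  \<comment> \<open>The overlap in \<open>v\<close> makes lengths, rather than cardinalities, add
    up.\<close>
  then have "C \<inter> D = {v}" using v by (auto intro: antisym)
  then have "card C + card D = card (C \<union> D) + 1"
    using card_Un_Int[OF fin] by simp
  moreover have "card C > 0" "card D > 0" using fin v by (auto simp: card_gt_0_iff)
  ultimately show "card (C \<union> D) - 1 = (card C - 1) + (card D - 1)" by simp
qed

text \<open>Any maximal chain below \<open>v\<close> glues with any maximal chain above
  \<open>v\<close> to one of length \<open>d\<close>. Fixing either of them forces the length of the
  other to be constant.\<close>

lemma graded_split:
  assumes A: "graded_of_rank A d" and "v \<in> A"
  shows "finite_graded {x \<in> A. x \<le> v}" and "finite_graded {x \<in> A. v \<le> x}"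
    and "poset_length {x \<in> A. x \<le> v} + poset_length {x \<in> A. v \<le> x} = d"
proof -
  let ?D = "{x \<in> A. x \<le> v}" and ?U = "{x \<in> A. v \<le> x}"
  have fin: "finite A" "finite ?D" "finite ?U" using A by (auto simp: graded_of_rank_def)
  obtain C where C: "pred_on.maxchain ?D (<) C"
    using chain_subset_maxchain[OF fin(2) pred_on.chain_empty] .
  obtain U where U: "pred_on.maxchain ?U (<) U"
    using chain_subset_maxchain[OF fin(3) pred_on.chain_empty] .
  have sum: "(card C' - 1) + (card U' - 1) = d"
    if "pred_on.maxchain ?D (<) C'" "pred_on.maxchain ?U (<) U'" for C' U'
    using maxchain_Un[OF assms(2) that fin(1)] A by (simp add: graded_of_rank_def)
  have D: "graded_of_rank ?D (card C - 1)"
    unfolding graded_of_rank_def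
  proof (intro conjI allI impI)
    fix C' assume "pred_on.maxchain ?D (<) C'"
    then show "card C' - 1 = card C - 1"
      using sum[OF _ U] C by (metis add_right_cancel)
  qed (use fin in auto)
  have U': "graded_of_rank ?U (card U - 1)"
    unfolding graded_of_rank_def
  proof (intro conjI allI impI)
    fix U' assume "pred_on.maxchain ?U (<) U'"
    then show "card U' - 1 = card U - 1"
      using sum[OF C] U by (metis add_left_cancel)
  qed (use fin in auto)
  show "finite_graded ?D" "finite_graded ?U" using D U' by (auto simp: finite_graded_def)
  show "poset_length ?D + poset_length ?U = d"
    using D U' sum[OF C U] by (simp add: graded_poset_length)
qed

lemma poset_length_singleton: "poset_length {v} = 0"
proof -
  have "poset_length {v} \<le> 0"
  proof (rule poset_length_le)
    fix C assume "pred_on.chain {v} (<) C"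
    then have "C \<subseteq> {v}" by (simp add: less_chain_iff)
    then have "card C \<le> card {v}" by (intro card_mono) auto
    then show "card C - 1 \<le> 0" by simp
  qed simp
  then show ?thesis by simp
qed

lemma poset_length_pos:
  assumes "finite A" and "s \<in> A" and "t \<in> A" and "s < t"
  shows "poset_length A > 0"
proof -
  have "card {s, t} - 1 \<le> poset_length A"
    using assms by (intro poset_length_ge) (auto simp: less_chain_iff)
  then show ?thesis using assms(4) by auto
qed

section \<open>Ranks and their additivity\<close>

lemma rk_int_refl [simp]:
  assumes "t \<in> P"
  shows "rk_int P t t = 0"
proof -
  have "interval P t t = {t}" using assms by (auto simp: interval_def)
  then show ?thesis by (simp add: rk_int_def poset_length_singleton)
qed

lemma finite_interval:
  assumes "locally_graded P" and "s \<in> P" and "t \<in> P"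
  shows "finite (interval P s t)"
proof (cases "s \<le> t")
  case True
  then show ?thesis
    using assms by (auto simp: locally_graded_def finite_graded_def graded_of_rank_def)
next
  case False
  then have "interval P s t = {}" by (auto simp: interval_def)
  then show ?thesis by simp
qed

lemma finite_princ_ideal:
  assumes "lower_graded P" and "t \<in> P"
  shows "finite (princ_ideal P t)"
  using assms by (auto simp: lower_graded_def finite_graded_def graded_of_rank_def)

lemma rk_int_add:
  assumes "locally_graded P" and "s \<in> P" "t \<in> P" "u \<in> P" "s \<le> t" "t \<le> u"
  shows "rk_int P s t + rk_int P t u = rk_int P s u"
proof -
  have "graded_of_rank (interval P s u) (rk_int P s u)"
    using assms by (auto simp: locally_graded_def rk_int_def simp flip: finite_graded_iff)
  moreover have "t \<in> interval P s u" using assms by (simp add: interval_def)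
  moreover have "{x \<in> interval P s u. x \<le> t} = interval P s t"
    "{x \<in> interval P s u. t \<le> x} = interval P t u"
    using assms by (auto simp: interval_def)
  ultimately show ?thesis
    using graded_split(3)[of "interval P s u" "rk_int P s u" t] by (simp add: rk_int_def)
qed

lemma rk_add:
  assumes "lower_graded P" and "s \<in> P" "t \<in> P" "s \<le> t"
  shows "rk P s + rk_int P s t = rk P t"
proof -
  have "graded_of_rank (princ_ideal P t) (rk P t)"
    using assms by (auto simp: lower_graded_def rk_def simp flip: finite_graded_iff)
  moreover have "s \<in> princ_ideal P t" using assms by (simp add: princ_ideal_def)
  moreover have "{x \<in> princ_ideal P t. x \<le> s} = princ_ideal P s"
    "{x \<in> princ_ideal P t. s \<le> x} = interval P s t"
    using assms by (auto simp: interval_def princ_ideal_def)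
  ultimately show ?thesis
    using graded_split(3)[of "princ_ideal P t" "rk P t" s] by (simp add: rk_int_def rk_def)
qed

lemma rk_int_pos:
  assumes "locally_graded P" and "s \<in> P" "t \<in> P" "s < t"
  shows "rk_int P s t > 0"
  unfolding rk_int_def using assms finite_interval[of P s t]
  by (intro poset_length_pos[of _ s t]) (auto simp: interval_def)

lemma rk_eq_0_iff:
  assumes "lower_graded P" and "t \<in> P"
  shows "rk P t = 0 \<longleftrightarrow> minimal_elt P t"
proof
  assume "rk P t = 0"
  have "\<not> s < t" if "s \<in> P" for s
  proof
    assume "s < t"
    then have "poset_length (princ_ideal P t) > 0"
      using assms that by (intro poset_length_pos[of _ s t])
        (simp_all add: finite_princ_ideal, simp_all add: princ_ideal_def)
    then show False using \<open>rk P t = 0\<close> by (simp add: rk_def)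
  qed
  then show "minimal_elt P t" using assms by (simp add: minimal_elt_def)
next
  assume "minimal_elt P t"
  then have "princ_ideal P t = {t}"
    by (auto simp: minimal_elt_def princ_ideal_def order.order_iff_strict)
  then show "rk P t = 0" by (simp add: rk_def poset_length_singleton)
qed

text \<open>Strict growth makes the rank a measure for recursion and induction along
  \<open>P\<close>.\<close>

lemma rk_less:
  assumes "lower_graded P" and "locally_graded P" and "s \<in> P" "t \<in> P" "s < t"
  shows "rk P s < rk P t"
  using rk_add[of P s t] rk_int_pos[of P s t] assms by (simp add: order.strict_implies_order)

section \<open>Incidence algebras\<close>

text \<open>The unitary elements. Ones on the diagonal permit inversion over any commutative ring,
  in particular over the integers and over K[x].\<close>

definition inc_unit :: "'a::order set \<Rightarrow> ('a \<Rightarrow> 'a \<Rightarrow> 'r::comm_ring_1) \<Rightarrow> bool" where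
  "inc_unit P g \<longleftrightarrow> g \<in> inc_alg P \<and> (\<forall>t\<in>P. g t t = 1)"

lemma inc_mult_assoc:
  fixes f g h :: "'a::order \<Rightarrow> 'a \<Rightarrow> 'r::comm_ring_1"
  assumes "locally_graded P"
  shows "inc_mult P (inc_mult P f g) h = inc_mult P f (inc_mult P g h)"
proof (intro ext)
  fix s u
  show "inc_mult P (inc_mult P f g) h s u = inc_mult P f (inc_mult P g h) s u"
  proof (cases "s \<in> P \<and> u \<in> P \<and> s \<le> u")
    case True
    have "inc_mult P (inc_mult P f g) h s u =
        (\<Sum>t\<in>interval P s u. \<Sum>r\<in>interval P s t. f s r * g r t * h t u)"
      using True by (auto simp: inc_mult_def interval_def sum_distrib_right intro!: sum.cong)
    also have "\<dots> = (\<Sum>(t, r)\<in>(SIGMA t:interval P s u. interval P s t). f s r * g r t * h t u)"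
      using True assms by (intro sum.Sigma ballI finite_interval) (auto simp: interval_def)
    also have "\<dots> = (\<Sum>(r, t)\<in>(SIGMA r:interval P s u. interval P r u). f s r * g r t * h t u)"
      by (rule sum.reindex_bij_witness[of _ "\<lambda>(a, b). (b, a)" "\<lambda>(a, b). (b, a)"])
        (auto simp: interval_def)
    also have "\<dots> = (\<Sum>r\<in>interval P s u. \<Sum>t\<in>interval P r u. f s r * g r t * h t u)"
      using True assms by (intro sum.Sigma[symmetric] ballI finite_interval) (auto simp: interval_def)
    also have "\<dots> = inc_mult P f (inc_mult P g h) s u"
      using True by (auto simp: inc_mult_def interval_def sum_distrib_left mult.assoc intro!: sum.cong)
    finally show ?thesis .
  qed (auto simp: inc_mult_def)
qed

lemma inc_mult_one_left:
  assumes "locally_graded P" and "g \<in> inc_alg P"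
  shows "inc_mult P (inc_one P) g = g"
proof (intro ext)
  fix s u
  show "inc_mult P (inc_one P) g s u = g s u"
  proof (cases "s \<in> P \<and> u \<in> P \<and> s \<le> u")
    case True
    then have "inc_mult P (inc_one P) g s u = (\<Sum>t\<in>interval P s u. if t = s then g s u else 0)"
      by (auto simp: inc_mult_def inc_one_def intro!: sum.cong)
    also have "\<dots> = g s u"
      using True assms by (subst sum.delta) (simp add: finite_interval, simp add: interval_def)
    finally show ?thesis .
  qed (use assms in \<open>auto simp: inc_mult_def inc_alg_def\<close>)
qed

lemma inc_mult_one_right:
  assumes "locally_graded P" and "g \<in> inc_alg P"
  shows "inc_mult P g (inc_one P) = g"
proof (intro ext)
  fix s u
  show "inc_mult P g (inc_one P) s u = g s u"
  proof (cases "s \<in> P \<and> u \<in> P \<and> s \<le> u")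
    case True
    then have "inc_mult P g (inc_one P) s u = (\<Sum>t\<in>interval P s u. if t = u then g s u else 0)"
      by (auto simp: inc_mult_def inc_one_def interval_def intro!: sum.cong)
    also have "\<dots> = g s u"
      using True assms by (subst sum.delta) (simp add: finite_interval, simp add: interval_def)
    finally show ?thesis .
  qed (use assms in \<open>auto simp: inc_mult_def inc_alg_def\<close>)
qed

text \<open>Because \<open>g u u = 1\<close>, the equation h g = 1 at (s, u) expresses the entry of
  h there through entries at (s, t) with t < u. The rank of the interval is the termination
  measure.\<close>

lemma inc_unit_left_inverse:
  fixes g :: "'a::order \<Rightarrow> 'a \<Rightarrow> 'r::comm_ring_1"
  assumes loc: "locally_graded P" and g: "inc_unit P g"
  obtains h where "inc_unit P h" and "inc_mult P h g = inc_one P"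
proof -
  \<comment> \<open>Only the right endpoint shrinks: each row of the inverse is computed from
    itself.\<close>
  define R where "R = {((s', t), (s, u)). s' = s \<and> s \<in> P \<and> t \<in> P \<and> u \<in> P \<and> s \<le> t \<and> t < (u :: 'a)}"
  \<comment> \<open>The recursion with the term t = u isolated. The value 0 away from the intervals
    places the solution in \<open>inc_alg\<close>.\<close>
  define good where "good = (\<lambda>h (s, u) (r :: 'r).
    r = (if s \<in> P \<and> u \<in> P \<and> s \<le> u
      then (if s = u then 1 else 0) - (\<Sum>t\<in>interval P s u - {u}. h (s, t) * g t u) else 0))"
  have "wf R"
  proof (rule wf_subset)
    show "wf (measure (\<lambda>(s, t). rk_int P s t))" by simp
    show "R \<subseteq> measure (\<lambda>(s, t). rk_int P s t)"
    proof clarsimp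
      fix s' t s u assume "((s', t), (s, u)) \<in> R"
      then have "s' = s" "s \<in> P" "t \<in> P" "u \<in> P" "s \<le> t" "t < u" by (auto simp: R_def)
      then show "rk_int P s' t < rk_int P s u"
        using rk_int_add[OF loc, of s t u] rk_int_pos[OF loc, of t u]
        by (simp add: order.strict_implies_order)
    qed
  qed
  then have "\<exists>h. \<forall>x. good h x (h x)"
  proof (rule dependent_wf_choice)
    fix h h' :: "'a \<times> 'a \<Rightarrow> 'r" and x r
    assume eq: "\<And>z. (z, x) \<in> R \<Longrightarrow> h z = h' z"
    obtain s u where x: "x = (s, u)" by (cases x)
    have "h (s, t) = h' (s, t)" if "s \<in> P" "u \<in> P" "t \<in> interval P s u - {u}" for t
      using that by (intro eq) (auto simp: R_def x interval_def)
    then have "(\<Sum>t\<in>interval P s u - {u}. h (s, t) * g t u) =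
        (\<Sum>t\<in>interval P s u - {u}. h' (s, t) * g t u)"
      if "s \<in> P" "u \<in> P"
      using that by (intro sum.cong) auto
    then show "good h x r = good h' x r"
      by (auto simp: good_def x)
  qed (auto simp: good_def)
  then obtain h where h: "\<And>s u. good h (s, u) (h (s, u))" by blast
  define h' where "h' s u = h (s, u)" for s u
  have eq: "h' s u = (if s = u then 1 else 0) - (\<Sum>t\<in>interval P s u - {u}. h' s t * g t u)"
    if "s \<in> P" "u \<in> P" "s \<le> u" for s u
    using h[of s u] that by (simp add: good_def h'_def)
  have "inc_unit P h'"
    unfolding inc_unit_def inc_alg_def
  proof (intro conjI ballI CollectI allI impI)
    fix s u assume "\<not> (s \<in> P \<and> u \<in> P \<and> s \<le> u)"
    then show "h' s u = 0" using h[of s u] by (auto simp: good_def h'_def)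
  next
    fix t assume "t \<in> P"
    moreover have "interval P t t - {t} = {}" by (auto simp: interval_def)
    ultimately show "h' t t = 1" using eq[of t t] by (simp only: sum.empty) simp
  qed
  moreover have "inc_mult P h' g = inc_one P"
  proof (intro ext)
    fix s u
    show "inc_mult P h' g s u = inc_one P s u"
    proof (cases "s \<in> P \<and> u \<in> P \<and> s \<le> u")
      case True
      then have "u \<in> interval P s u" by (simp add: interval_def)
      then have "inc_mult P h' g s u = h' s u * g u u + (\<Sum>t\<in>interval P s u - {u}. h' s t * g t u)"
        using True finite_interval[OF loc, of s u] by (simp add: inc_mult_def sum.remove)
      also have "\<dots> = inc_one P s u"
        using eq[of s u] True g by (simp add: inc_unit_def inc_one_def)
      finally show ?thesis .
    qed (auto simp: inc_mult_def inc_one_def)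
  qed
  ultimately show thesis by (rule that)
qed

lemma inc_inv_eqI:
  fixes g :: "'a::order \<Rightarrow> 'a \<Rightarrow> 'r::comm_ring_1"
  assumes loc: "locally_graded P"
    and h: "h \<in> inc_alg P" "inc_mult P g h = inc_one P" "inc_mult P h g = inc_one P"
  shows "inc_inv P g = h"
  unfolding inc_inv_def
proof (rule the_equality)
  fix h' assume h': "h' \<in> inc_alg P \<and> inc_mult P g h' = inc_one P \<and> inc_mult P h' g = inc_one P"
  have "h' = inc_mult P h' (inc_mult P g h)"
    using h h' by (simp add: inc_mult_one_right[OF loc])
  also have "\<dots> = inc_mult P (inc_mult P h' g) h" by (simp only: inc_mult_assoc[OF loc])
  also have "\<dots> = h"
    using h h' by (simp add: inc_mult_one_left[OF loc])
  finally show "h' = h" .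
qed (use h in simp)

text \<open>A left inverse \<open>h\<close> of \<open>g\<close> is unitary, so it has a left inverse
  \<open>k\<close> of its own. Associativity yields \<open>k = g\<close>, and \<open>h\<close> is
  two-sided.\<close>

lemma inc_inv:
  fixes g :: "'a::order \<Rightarrow> 'a \<Rightarrow> 'r::comm_ring_1"
  assumes loc: "locally_graded P" and g: "inc_unit P g"
  shows "inc_inv P g \<in> inc_alg P" and "inc_mult P g (inc_inv P g) = inc_one P"
    and "inc_mult P (inc_inv P g) g = inc_one P"
proof -
  obtain h where h: "inc_unit P h" "inc_mult P h g = inc_one P"
    using inc_unit_left_inverse[OF loc g] .
  obtain k where k: "inc_unit P k" "inc_mult P k h = inc_one P"
    using inc_unit_left_inverse[OF loc h(1)] .
  have "k = inc_mult P k (inc_mult P h g)"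
    using h k by (simp add: inc_mult_one_right[OF loc] inc_unit_def)
  also have "\<dots> = inc_mult P (inc_mult P k h) g" by (simp only: inc_mult_assoc[OF loc])
  also have "\<dots> = g"
    using k g by (simp add: inc_mult_one_left[OF loc] inc_unit_def)
  finally have "inc_mult P g h = inc_one P" using k by simp
  then have "inc_inv P g = h"
    using h by (intro inc_inv_eqI[OF loc]) (auto simp: inc_unit_def)
  with h \<open>inc_mult P g h = inc_one P\<close>
  show "inc_inv P g \<in> inc_alg P" "inc_mult P g (inc_inv P g) = inc_one P"
    "inc_mult P (inc_inv P g) g = inc_one P"
    by (auto simp: inc_unit_def)
qed

text \<open>Convexity of \<open>I\<close> keeps every convolution between elements of
  \<open>I\<close> inside \<open>I\<close>, so the restricted inverse is again an inverse. This is
  needed to compare the inverse of xi on a principal ideal with the one on \<open>P\<close>.\<close>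

lemma inc_inv_convex_subset:
  fixes g g' :: "'a::order \<Rightarrow> 'a \<Rightarrow> 'r::comm_ring_1"
  assumes loc: "locally_graded P" and g: "inc_unit P g" and "I \<subseteq> P" and loc': "locally_graded I"
    and int: "\<And>s t. s \<in> I \<Longrightarrow> t \<in> I \<Longrightarrow> interval I s t = interval P s t"
    and eq: "\<And>s t. s \<in> I \<Longrightarrow> t \<in> I \<Longrightarrow> g' s t = g s t"
    and st: "s \<in> I" "t \<in> I"
  shows "inc_inv I g' s t = inc_inv P g s t"
proof -
  define h where "h s t = (if s \<in> I \<and> t \<in> I then inc_inv P g s t else 0)" for s t
  have mem: "r \<in> I" if "s \<in> I" "t \<in> I" "r \<in> interval P s t" for r s t
    using int[OF that(1,2)] that(3) by (auto simp: interval_def)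
  have "inc_inv I g' = h"
  proof (rule inc_inv_eqI[OF loc'])
    show "h \<in> inc_alg I"
      using inc_inv(1)[OF loc g] \<open>I \<subseteq> P\<close> by (auto simp: inc_alg_def h_def)
    have mult: "inc_mult I a' b' = inc_one I"
      if ab: "inc_mult P a b = inc_one P"
        and "\<And>s t. s \<in> I \<Longrightarrow> t \<in> I \<Longrightarrow> a' s t = a s t"
        and "\<And>s t. s \<in> I \<Longrightarrow> t \<in> I \<Longrightarrow> b' s t = b s t"
      for a b a' b' :: "'a \<Rightarrow> 'a \<Rightarrow> 'r"
    proof (intro ext)
      fix s t
      show "inc_mult I a' b' s t = inc_one I s t"
      proof (cases "s \<in> I \<and> t \<in> I \<and> s \<le> t")
        case True
        then have "inc_mult I a' b' s t = (\<Sum>r\<in>interval P s t. a s r * b r t)"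
          using that(2,3) mem[of s t] by (simp add: inc_mult_def int)
        also have "\<dots> = inc_mult P a b s t"
          using True \<open>I \<subseteq> P\<close> by (auto simp: inc_mult_def)
        also have "\<dots> = inc_one I s t"
          using True \<open>I \<subseteq> P\<close> by (auto simp: ab inc_one_def)
        finally show ?thesis .
      qed (auto simp: inc_mult_def inc_one_def)
    qed
    show "inc_mult I g' h = inc_one I"
      by (rule mult[OF inc_inv(2)[OF loc g]]) (auto simp: eq h_def)
    show "inc_mult I h g' = inc_one I"
      by (rule mult[OF inc_inv(3)[OF loc g]]) (auto simp: eq h_def)
  qed
  then show ?thesis using st by (simp add: h_def)
qed

section \<open>The functions gamma and xi\<close>

text \<open>Trades the Moebius function for an alternating sum that refers to intervals alone, so
  that it passes to convex subposets without handling inverses.\<close>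

definition eulerian :: "'a::order set \<Rightarrow> bool" where
  "eulerian P \<longleftrightarrow> lower_graded P \<and> locally_graded P \<and>
     (\<forall>s\<in>P. \<forall>t\<in>P. s < t \<longrightarrow> (\<Sum>r\<in>interval P s t. (-1) ^ rk_int P r t) = (0 :: int))"

text \<open>The alternating sum is the off-diagonal entry of zeta times the Moebius function, which
  is the identity.\<close>

lemma eulerian_if_locally_Eulerian:
  assumes "lower_graded P" and "locally_Eulerian P"
  shows "eulerian P"
  unfolding eulerian_def
proof (intro conjI ballI impI)
  show loc: "locally_graded P" using assms(2) by (simp add: locally_Eulerian_def)
  fix s t assume st: "s \<in> P" "t \<in> P" "s < t"
  have "inc_unit P (inc_zeta P :: _ \<Rightarrow> _ \<Rightarrow> int)"
    by (auto simp: inc_unit_def inc_alg_def inc_zeta_def)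
  then have "inc_mult P (inc_zeta P) (moebius P) = inc_one P"
    unfolding moebius_def by (rule inc_inv(2)[OF loc])
  then have "inc_mult P (inc_zeta P) (moebius P) s t = 0"
    using st by (simp add: inc_one_def)
  then have "(\<Sum>r\<in>interval P s t. inc_zeta P s r * moebius P r t) = 0"
    using st by (simp add: inc_mult_def order.strict_implies_order)
  moreover have "inc_zeta P s r * moebius P r t = (-1) ^ rk_int P r t" if "r \<in> interval P s t" for r
    using that st assms(2) by (simp add: inc_zeta_def interval_def locally_Eulerian_def)
  ultimately show "(\<Sum>r\<in>interval P s t. (-1) ^ rk_int P r t) = (0 :: int)" by simp
qed (use assms in simp)

text \<open>Interval ranks and alternating sums are computed within intervals. Lower gradedness is a
  separate matter, since principal ideals may shrink in \<open>F\<close>.\<close>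

lemma eulerian_convex_subset:
  assumes P: "eulerian P" and "F \<subseteq> P" and "lower_graded F"
    and int: "\<And>s t. s \<in> F \<Longrightarrow> t \<in> F \<Longrightarrow> interval F s t = interval P s t"
  shows "eulerian F"
  unfolding eulerian_def
proof (intro conjI ballI impI)
  show "locally_graded F"
    using P \<open>F \<subseteq> P\<close> unfolding eulerian_def locally_graded_def by (metis int subsetD)
  fix s t assume st: "s \<in> F" "t \<in> F" "s < t"
  have "rk_int F r t = rk_int P r t" if "r \<in> interval P s t" for r
  proof -
    have "r \<in> interval F s t" using that int[of s t] st by simp
    then show ?thesis using int[of r t] st by (simp add: rk_int_def interval_def)
  qed
  then have "(\<Sum>r\<in>interval F s t. (-1) ^ rk_int F r t) =
      (\<Sum>r\<in>interval P s t. (-1) ^ rk_int P r t :: int)"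
    using st by (simp add: int)
  also have "\<dots> = 0"
    using P \<open>F \<subseteq> P\<close> st unfolding eulerian_def by blast
  finally show "(\<Sum>r\<in>interval F s t. (-1) ^ rk_int F r t) = (0 :: int)" .
qed (use assms in simp)

section \<open>Order ideals and principal filters\<close>

lemma princ_ideal_order_ideal:
  assumes "order_ideal I P" and "t \<in> I"
  shows "princ_ideal I t = princ_ideal P t"
  using assms by (auto simp: order_ideal_def princ_ideal_def)

lemma interval_order_ideal:
  assumes "order_ideal I P" and "t \<in> I"
  shows "interval I s t = interval P s t"
  using assms by (auto simp: order_ideal_def interval_def)

lemma rk_order_ideal: "order_ideal I P \<Longrightarrow> t \<in> I \<Longrightarrow> rk I t = rk P t"
  by (simp add: rk_def princ_ideal_order_ideal)

lemma rk_int_order_ideal: "order_ideal I P \<Longrightarrow> t \<in> I \<Longrightarrow> rk_int I s t = rk_int P s t"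
  by (simp add: rk_int_def interval_order_ideal)

lemma minimal_elt_order_ideal:
  "order_ideal I P \<Longrightarrow> t \<in> I \<Longrightarrow> minimal_elt I t \<longleftrightarrow> minimal_elt P t"
  by (auto simp: minimal_elt_def order_ideal_def)

lemma eulerian_order_ideal:
  assumes "eulerian P" and I: "order_ideal I P"
  shows "eulerian I"
proof (rule eulerian_convex_subset[OF assms(1)])
  show "I \<subseteq> P" using I by (simp add: order_ideal_def)
  then show "lower_graded I"
    using assms(1) by (auto simp: eulerian_def lower_graded_def princ_ideal_order_ideal[OF I])
qed (simp add: interval_order_ideal[OF I])

lemma order_ideal_princ_ideal: "order_ideal (princ_ideal P u) P"
  by (auto simp: order_ideal_def princ_ideal_def)

text \<open>The dictionary between xi and gamma: ideals of the filter at \<open>s\<close> are the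
  intervals starting at \<open>s\<close>, so the rank on the filter is rho(s, t).\<close>

lemma princ_ideal_princ_filter: "princ_ideal (princ_filter P s) t = interval P s t"
  by (auto simp: princ_ideal_def princ_filter_def interval_def)

lemma interval_princ_filter: "r \<in> princ_filter P s \<Longrightarrow> interval (princ_filter P s) r t = interval P r t"
  by (auto simp: princ_filter_def interval_def)

lemma rk_princ_filter: "rk (princ_filter P s) t = rk_int P s t"
  by (simp add: rk_def rk_int_def princ_ideal_princ_filter)

lemma rk_int_princ_filter: "r \<in> princ_filter P s \<Longrightarrow> rk_int (princ_filter P s) r t = rk_int P r t"
  by (simp add: rk_int_def interval_princ_filter)

lemma minimal_elt_princ_filter: "s \<in> P \<Longrightarrow> minimal_elt (princ_filter P s) t \<longleftrightarrow> t = s"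
  by (auto simp: minimal_elt_def princ_filter_def order.order_iff_strict)

lemma eulerian_princ_filter:
  assumes "eulerian P" and "s \<in> P"
  shows "eulerian (princ_filter P s)"
proof (rule eulerian_convex_subset[OF assms(1)])
  show "princ_filter P s \<subseteq> P" by (auto simp: princ_filter_def)
  show "lower_graded (princ_filter P s)"
    unfolding lower_graded_def princ_ideal_princ_filter
    using assms by (auto simp: eulerian_def locally_graded_def princ_filter_def)
qed (simp add: interval_princ_filter)

text \<open>Powers of 1 - x are the reflected powers of x - 1, so this is the kernel property of
  lambda off the diagonal. By additivity of ranks a common power of x - 1 factors out and leaves the
  Eulerian alternating sum.\<close>

lemma alternating_kernel:
  assumes P: "eulerian P" and "r \<in> P" "t \<in> P" "r < t"
  shows "(\<Sum>s\<in>interval P r t. [:-1, 1 :: int:] ^ rk_int P r s * [:1, -1:] ^ rk_int P s t) = 0"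
proof -
  have loc: "locally_graded P" using P by (simp add: eulerian_def)
  have neg: "[:1, -1 :: int:] = [:-1:] * [:-1, 1:]" by simp
  have "[:-1, 1 :: int:] ^ rk_int P r s * [:1, -1:] ^ rk_int P s t =
      [:(-1) ^ rk_int P s t:] * [:-1, 1:] ^ rk_int P r t" if "s \<in> interval P r t" for s
  proof -
    have "rk_int P r t = rk_int P r s + rk_int P s t"
      using that assms by (intro rk_int_add[OF loc, symmetric]) (auto simp: interval_def)
    moreover have "[:1, -1 :: int:] ^ n = [:(-1) ^ n:] * [:-1, 1:] ^ n" for n
      unfolding neg power_mult_distrib by (simp add: poly_const_pow)
    ultimately show ?thesis by (simp only: power_add mult_ac)
  qed
  then have "(\<Sum>s\<in>interval P r t. [:-1, 1 :: int:] ^ rk_int P r s * [:1, -1:] ^ rk_int P s t) =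
      (\<Sum>s\<in>interval P r t. [:(-1) ^ rk_int P s t:]) * [:-1, 1:] ^ rk_int P r t"
    unfolding sum_distrib_right by (rule sum.cong[OF refl])
  also have "(\<Sum>s\<in>interval P r t. [:(-1 :: int) ^ rk_int P s t:]) =
      [:\<Sum>s\<in>interval P r t. (-1) ^ rk_int P s t:]"
    by (intro poly_eqI) (simp add: coeff_sum coeff_pCons split: nat.splits)
  finally show ?thesis using assms by (simp add: eulerian_def)
qed

text \<open>
  The conditions characterizing \<open>\<gamma>(P, \<lambda>)\<close>, with polynomial reflection in place of the bar
  operation so that they make sense over the integers as well.
\<close>

definition is_gamma :: "'a::order set \<Rightarrow> ('a \<Rightarrow> 'r::idom poly) \<Rightarrow> bool" where
  "is_gamma P f \<longleftrightarrow>
     (\<forall>t\<in>P. reflect_to (rk P t) (f t) = (\<Sum>s\<in>princ_ideal P t. f s * [:-1, 1:] ^ rk_int P s t)) \<and>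
     (\<forall>a. minimal_elt P a \<longrightarrow> f a = 1) \<and>
     (\<forall>t\<in>P. rk P t \<ge> 1 \<longrightarrow> degree (f t) \<le> (rk P t - 1) div 2)"

section \<open>Uniqueness and existence of gamma\<close>

lemma is_gamma_degree:
  assumes "lower_graded P" and "is_gamma P f" and "t \<in> P"
  shows "degree (f t) \<le> rk P t"
proof (cases "rk P t = 0")
  case True
  then show ?thesis using assms by (simp add: rk_eq_0_iff is_gamma_def)
next
  case False
  then have "degree (f t) \<le> (rk P t - 1) div 2" using assms by (simp add: is_gamma_def)
  then show ?thesis by linarith
qed

lemma princ_ideal_sum_remove:
  assumes "lower_graded P" and "t \<in> P"
  shows "(\<Sum>s\<in>princ_ideal P t. f s) = f t + (\<Sum>s\<in>princ_ideal P t - {t}. f s)"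
  using assms by (intro sum.remove finite_princ_ideal) (auto simp: princ_ideal_def)

text \<open>Induction on rank: with the term s = t isolated, acceptability prescribes the reflection
  of \<open>f t\<close> minus \<open>f t\<close> through lower values, and the degree bound recovers
  \<open>f t\<close>.\<close>

lemma is_gamma_unique:
  fixes f g :: "'a::order \<Rightarrow> 'b::idom poly"
  assumes "lower_graded P" and "locally_graded P" and f: "is_gamma P f" and g: "is_gamma P g"
    and "t \<in> P"
  shows "f t = g t"
  using \<open>t \<in> P\<close>
proof (induction "rk P t" arbitrary: t rule: less_induct)
  case less
  show ?case
  proof (cases "rk P t = 0")
    case True
    then show ?thesis using f g less.prems assms(1) by (simp add: rk_eq_0_iff is_gamma_def)
  next
    case False
    have "f s = g s" if "s \<in> princ_ideal P t - {t}" for s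
      using that less rk_less[OF assms(1,2), of s t] by (auto simp: princ_ideal_def)
    then have "(\<Sum>s\<in>princ_ideal P t - {t}. f s * [:-1, 1:] ^ rk_int P s t) =
        (\<Sum>s\<in>princ_ideal P t - {t}. g s * [:-1, 1:] ^ rk_int P s t)" by simp
    moreover have "reflect_to (rk P t) (h t) - h t =
        (\<Sum>s\<in>princ_ideal P t - {t}. h s * [:-1, 1:] ^ rk_int P s t)"
      if "is_gamma P h" for h :: "'a \<Rightarrow> 'b poly"
      using that less.prems by (simp add: is_gamma_def princ_ideal_sum_remove[OF assms(1)])
    ultimately have "reflect_to (rk P t) (f t) - f t = reflect_to (rk P t) (g t) - g t"
      using f g by simp
    moreover have "degree (f t) \<le> (rk P t - 1) div 2" "degree (g t) \<le> (rk P t - 1) div 2"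
      using False f g less.prems unfolding is_gamma_def by auto
    ultimately show ?thesis
      using False low_degree_determined_by_antisymmetrization[of "rk P t" "f t" "g t"] by simp
  qed
qed

lemma sum_princ_ideal_interval_swap:
  fixes F :: "'a::order \<Rightarrow> 'a \<Rightarrow> 'b::comm_monoid_add"
  assumes P: "lower_graded P" "locally_graded P" and t: "t \<in> P"
  shows "(\<Sum>s\<in>princ_ideal P t. \<Sum>r\<in>princ_ideal P s. F r s) =
    (\<Sum>r\<in>princ_ideal P t. \<Sum>s\<in>interval P r t. F r s)"
proof -
  have "(\<Sum>s\<in>princ_ideal P t. \<Sum>r\<in>princ_ideal P s. F r s) =
      (\<Sum>(s, r)\<in>(SIGMA s:princ_ideal P t. princ_ideal P s). F r s)"
    using P t by (intro sum.Sigma ballI finite_princ_ideal) (auto simp: princ_ideal_def)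
  also have "\<dots> = (\<Sum>(r, s)\<in>(SIGMA r:princ_ideal P t. interval P r t). F r s)"
    by (rule sum.reindex_bij_witness[of _ "\<lambda>(a, b). (b, a)" "\<lambda>(a, b). (b, a)"])
      (auto simp: interval_def princ_ideal_def)
  also have "\<dots> = (\<Sum>r\<in>princ_ideal P t. \<Sum>s\<in>interval P r t. F r s)"
    using P t by (intro sum.Sigma[symmetric] ballI finite_princ_ideal finite_interval)
      (auto simp: princ_ideal_def)
  finally show ?thesis .
qed

lemma degree_mult_linear_power_le:
  fixes p :: "'r::idom poly"
  assumes "degree p \<le> m" and "m + k \<le> n"
  shows "degree (p * [:-1, 1:] ^ k) \<le> n"
proof -
  have "degree (p * [:-1, 1:] ^ k) \<le> degree p + k"
    using degree_mult_le[of p "[:-1, 1:] ^ k"] unfolding degree_linear_power .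
  then show ?thesis using assms by linarith
qed

text \<open>\<open>w\<close> is f lambda at \<open>t\<close> without its diagonal term. Reflecting
  it and using acceptability below \<open>t\<close> produces sums of lambda against reflected
  lambda, which \<open>alternating_kernel\<close> collapses.\<close>

lemma sum_below_antisymmetric:
  fixes f :: "'a::order \<Rightarrow> int poly"
  assumes P: "eulerian P" and t: "t \<in> P"
    and deg: "\<And>s. s \<in> princ_ideal P t - {t} \<Longrightarrow> degree (f s) \<le> rk P s"
    and acc: "\<And>s. s \<in> princ_ideal P t - {t} \<Longrightarrow>
      reflect_to (rk P s) (f s) = (\<Sum>r\<in>princ_ideal P s. f r * [:-1, 1:] ^ rk_int P r s)"
  defines "w \<equiv> \<Sum>s\<in>princ_ideal P t - {t}. f s * [:-1, 1:] ^ rk_int P s t"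
  shows "degree w \<le> rk P t" and "reflect_to (rk P t) w = - w"
proof -
  have low: "lower_graded P" and loc: "locally_graded P" using P by (auto simp: eulerian_def)
  have below: "s \<in> P" "s < t" "rk P s + rk_int P s t = rk P t"
    if "s \<in> princ_ideal P t - {t}" for s
    using that t rk_add[OF low, of s t] by (auto simp: princ_ideal_def)
  show "degree w \<le> rk P t"
    unfolding w_def
  proof (intro degree_sum_le finite_Diff finite_princ_ideal[OF low t])
    fix s assume "s \<in> princ_ideal P t - {t}"
    then show "degree (f s * [:-1, 1:] ^ rk_int P s t) \<le> rk P t"
      using degree_mult_linear_power_le[OF deg, of s] below(3)[of s] by simp
  qed
  \<comment> \<open>The (r, s) term of f times lambda times reflected lambda, evaluated at
    \<open>t\<close>.\<close>
  define G where "G r s = f r * ([:-1, 1:] ^ rk_int P r s * [:1, -1:] ^ rk_int P s t)" for r s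
  have "reflect_to (rk P t) w =
      (\<Sum>s\<in>princ_ideal P t - {t}. reflect_to (rk P t) (f s * [:-1, 1:] ^ rk_int P s t))"
    unfolding w_def by (rule reflect_to_sum)
  also have "\<dots> = (\<Sum>s\<in>princ_ideal P t - {t}. \<Sum>r\<in>princ_ideal P s. G r s)"
  proof (rule sum.cong[OF refl])
    fix s assume s: "s \<in> princ_ideal P t - {t}"
    then have "reflect_to (rk P s + rk_int P s t) (f s * [:-1, 1:] ^ rk_int P s t) =
        reflect_to (rk P s) (f s) * [:1, -1:] ^ rk_int P s t"
      using deg by (subst reflect_to_mult) (auto simp: degree_linear_power reflect_to_linear_power)
    then show "reflect_to (rk P t) (f s * [:-1, 1:] ^ rk_int P s t) = (\<Sum>r\<in>princ_ideal P s. G r s)"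
      using below(1-3)[OF s] acc[OF s] by (simp add: G_def sum_distrib_right mult.assoc)
  qed
  \<comment> \<open>Adjoining and subtracting the terms with s = t completes the inner sums to full
    intervals once the order of summation is exchanged.\<close>
  also have "\<dots> = (\<Sum>s\<in>princ_ideal P t. \<Sum>r\<in>princ_ideal P s. G r s) - (\<Sum>r\<in>princ_ideal P t. G r t)"
    by (simp add: princ_ideal_sum_remove[OF low t, of "\<lambda>s. \<Sum>r\<in>princ_ideal P s. G r s"])
  finally have w: "reflect_to (rk P t) w =
      (\<Sum>s\<in>princ_ideal P t. \<Sum>r\<in>princ_ideal P s. G r s) - (\<Sum>r\<in>princ_ideal P t. G r t)" .
  have "(\<Sum>s\<in>princ_ideal P t. \<Sum>r\<in>princ_ideal P s. G r s) =
      (\<Sum>r\<in>princ_ideal P t. \<Sum>s\<in>interval P r t. G r s)"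
    by (rule sum_princ_ideal_interval_swap[OF low loc t])
  also have "\<dots> = f t"
  proof -
    have "(\<Sum>s\<in>interval P r t. G r s) = 0" if "r \<in> princ_ideal P t - {t}" for r
      using alternating_kernel[OF P, of r t] below(1-3)[OF that] t
      by (simp add: G_def flip: sum_distrib_left)
    moreover have "interval P t t = {t}" using t by (auto simp: interval_def)
    moreover have "G t t = f t" using t by (simp add: G_def)
    ultimately show ?thesis
      by (simp add: princ_ideal_sum_remove[OF low t, of "\<lambda>r. \<Sum>s\<in>interval P r t. G r s"])
  qed
  finally have "(\<Sum>s\<in>princ_ideal P t. \<Sum>r\<in>princ_ideal P s. G r s) = f t" .
  \<comment> \<open>The still unconstrained value \<open>f t\<close> occurs in both sums and
    cancels.\<close>
  moreover have "(\<Sum>r\<in>princ_ideal P t. G r t) = f t + w"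
  proof -
    have "G r t = f r * [:-1, 1:] ^ rk_int P r t" for r using t by (simp add: G_def)
    then show ?thesis
      using t by (subst princ_ideal_sum_remove[OF low t]) (simp add: w_def)
  qed
  ultimately show "reflect_to (rk P t) w = - w" using w by simp
qed

text \<open>Recursion along the order: at positive rank the contribution of lower elements is
  antisymmetric, and \<open>antisymmetric_poly_decomposition\<close> supplies a value of low
  degree.\<close>

lemma is_gamma_exists_int:
  assumes P: "eulerian P"
  obtains f :: "'a::order \<Rightarrow> int poly" where "is_gamma P f"
proof -
  have low: "lower_graded P" and loc: "locally_graded P" using P by (auto simp: eulerian_def)
  define R where "R = {(s, t). s \<in> P \<and> t \<in> P \<and> s < t}"
  \<comment> \<open>\<open>good f t r\<close> makes \<open>r\<close> an admissible value at
    \<open>t\<close>. The diagonal term is split off so that only values strictly below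
    \<open>t\<close> enter; outside \<open>P\<close> everything is admissible.\<close>
  define good where "good f t r \<longleftrightarrow> (t \<in> P \<longrightarrow>
     reflect_to (rk P t) r = r + (\<Sum>s\<in>princ_ideal P t - {t}. f s * [:-1, 1:] ^ rk_int P s t) \<and>
     (minimal_elt P t \<longrightarrow> r = 1) \<and>
     (rk P t \<ge> 1 \<longrightarrow> degree r \<le> (rk P t - 1) div 2))" for f :: "'a \<Rightarrow> int poly" and t r
  have "wf R"
    by (rule wf_subset[OF wf_measure[of "rk P"]]) (auto simp: R_def rk_less[OF low loc])
  then have "\<exists>f. \<forall>x. good f x (f x)"
  proof (rule dependent_wf_choice)
    fix f g :: "'a \<Rightarrow> int poly" and t r
    assume eq: "\<And>s. (s, t) \<in> R \<Longrightarrow> f s = g s"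
    have "f s = g s" if "t \<in> P" "s \<in> princ_ideal P t - {t}" for s
      using that by (intro eq) (auto simp: R_def princ_ideal_def)
    then have "t \<in> P \<Longrightarrow> (\<Sum>s\<in>princ_ideal P t - {t}. f s * [:-1, 1:] ^ rk_int P s t) =
        (\<Sum>s\<in>princ_ideal P t - {t}. g s * [:-1, 1:] ^ rk_int P s t)"
      by (intro sum.cong) auto
    then show "good f t r = good g t r" by (auto simp: good_def)
  next
    fix t and f :: "'a \<Rightarrow> int poly"
    assume IH: "\<And>s. (s, t) \<in> R \<Longrightarrow> good f s (f s)"
    show "\<exists>r. good f t r"
    proof (cases "t \<in> P \<and> rk P t \<noteq> 0")
      \<comment> \<open>Outside \<open>P\<close> there is nothing to show; at rank 0 the sum below
        is empty and 1 is its own reflection.\<close>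
      case False
      moreover have "(\<Sum>s\<in>princ_ideal P t - {t}. f s * [:-1, 1:] ^ rk_int P s t) = 0"
        if "minimal_elt P t"
        using that by (intro sum.neutral) (auto simp: minimal_elt_def princ_ideal_def)
      ultimately have "good f t 1"
        using rk_eq_0_iff[OF low, of t] by (auto simp: good_def reflect_to_one)
      then show ?thesis ..
    next
      case True
      then have t: "t \<in> P" and "rk P t \<ge> 1" by auto
      define w where "w = (\<Sum>s\<in>princ_ideal P t - {t}. f s * [:-1, 1:] ^ rk_int P s t)"
      have below: "(s, t) \<in> R" "s \<in> P" if "s \<in> princ_ideal P t - {t}" for s
        using that t by (auto simp: princ_ideal_def R_def)
      have deg: "degree (f s) \<le> rk P s" if "s \<in> princ_ideal P t - {t}" for s
      proof (cases "rk P s = 0")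
        case True
        then show ?thesis
          using IH[OF below(1)[OF that]] below(2)[OF that] rk_eq_0_iff[OF low, of s]
          by (simp add: good_def)
      next
        case False
        then have "degree (f s) \<le> (rk P s - 1) div 2"
          using IH[OF below(1)[OF that]] below(2)[OF that] by (simp add: good_def)
        then show ?thesis by linarith
      qed
      have acc: "reflect_to (rk P s) (f s) = (\<Sum>r\<in>princ_ideal P s. f r * [:-1, 1:] ^ rk_int P r s)"
        if "s \<in> princ_ideal P t - {t}" for s
      proof -
        have "reflect_to (rk P s) (f s) =
            f s + (\<Sum>r\<in>princ_ideal P s - {s}. f r * [:-1, 1:] ^ rk_int P r s)"
          using IH[OF below(1)[OF that]] below(2)[OF that] by (simp add: good_def)
        also have "\<dots> = (\<Sum>r\<in>princ_ideal P s. f r * [:-1, 1:] ^ rk_int P r s)"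
          by (subst princ_ideal_sum_remove[OF low below(2)[OF that]]) (simp add: below(2)[OF that])
        finally show ?thesis .
      qed
      have "degree w \<le> rk P t" "reflect_to (rk P t) w = - w"
        using sum_below_antisymmetric[OF P t deg acc] unfolding w_def by blast+
      then obtain r where "degree r \<le> (rk P t - 1) div 2" "reflect_to (rk P t) r = r + w"
        using antisymmetric_poly_decomposition[OF \<open>rk P t \<ge> 1\<close> \<open>degree w \<le> rk P t\<close>] by blast
      then have "good f t r"
        using rk_eq_0_iff[OF low t] True by (simp add: good_def w_def)
      then show ?thesis ..
    qed
  qed
  then obtain f where f: "\<And>t. good f t (f t)" by blast
  have "is_gamma P f"
    unfolding is_gamma_def
  proof (intro conjI ballI allI impI)
    fix t assume "t \<in> P"
    then show "reflect_to (rk P t) (f t) = (\<Sum>s\<in>princ_ideal P t. f s * [:-1, 1:] ^ rk_int P s t)"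
      using f[of t] by (simp add: good_def princ_ideal_sum_remove[OF low])
  qed (use f in \<open>auto simp: good_def minimal_elt_def\<close>)
  then show thesis by (rule that)
qed

text \<open>The conditions are identities with integer coefficients, preserved by the map from the
  integers to the field; degrees can only drop.\<close>

lemma is_gamma_of_int:
  assumes "is_gamma P f"
  shows "is_gamma P (\<lambda>t. map_poly of_int (f t) :: 'k::field poly)"
  unfolding is_gamma_def
proof (intro conjI ballI allI impI)
  fix t assume "t \<in> P"
  then have "reflect_to (rk P t) (f t) = (\<Sum>s\<in>princ_ideal P t. f s * [:-1, 1:] ^ rk_int P s t)"
    using assms by (simp add: is_gamma_def)
  then have "reflect_to (rk P t) (map_poly of_int (f t) :: 'k poly) =
      map_poly of_int (\<Sum>s\<in>princ_ideal P t. f s * [:-1, 1:] ^ rk_int P s t)"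
    by (simp flip: map_poly_of_int_reflect_to)
  then show "reflect_to (rk P t) (map_poly of_int (f t) :: 'k poly) =
      (\<Sum>s\<in>princ_ideal P t. map_poly of_int (f s) * [:-1, 1:] ^ rk_int P s t)"
    by (simp add: map_poly_of_int_sum map_poly_of_int_mult map_poly_of_int_power map_poly_pCons)
next
  fix t assume "t \<in> P" "1 \<le> rk P t"
  then have "degree (f t) \<le> (rk P t - 1) div 2" using assms by (simp add: is_gamma_def)
  then show "degree (map_poly of_int (f t) :: 'k poly) \<le> (rk P t - 1) div 2"
    by (intro degree_le) (auto simp: coeff_map_poly coeff_eq_0)
qed (use assms in \<open>auto simp: is_gamma_def map_poly_1\<close>)

lemma acceptable_lam_iff:
  fixes f :: "'a::order \<Rightarrow> 'k::field poly"
  assumes "\<And>t. t \<in> P \<Longrightarrow> degree (f t) \<le> rk P t"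
  shows "acceptable P (lam P) f \<longleftrightarrow>
    (\<forall>t\<in>P. reflect_to (rk P t) (f t) = (\<Sum>s\<in>princ_ideal P t. f s * [:-1, 1:] ^ rk_int P s t))"
proof -
  have "(\<Sum>s\<in>princ_ideal P t. f s * lam P s t) =
      (\<Sum>s\<in>princ_ideal P t. f s * [:-1, 1:] ^ rk_int P s t)" if "t \<in> P" for t
    using that by (intro sum.cong) (auto simp: lam_def princ_ideal_def)
  then show ?thesis
    unfolding acceptable_def
    by (auto simp: bar_eq_reflect_to[OF assms] simp del: to_fract_sum to_fract_mult)
qed

text \<open>The normalization and the degree condition already bound the degree by the rank, so
  \<open>bar\<close> may be replaced by reflection.\<close>

lemma gam_conditions_iff:
  fixes f :: "'a::order \<Rightarrow> 'k::field poly"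
  assumes "lower_graded P"
  shows "acceptable P (lam P) f \<and> (\<forall>a. minimal_elt P a \<longrightarrow> f a = 1) \<and>
     (\<forall>t\<in>P. rk P t \<ge> 1 \<longrightarrow> degree (f t) \<le> (rk P t - 1) div 2) \<longleftrightarrow> is_gamma P f"
proof -
  have "degree (f t) \<le> rk P t"
    if "\<forall>a. minimal_elt P a \<longrightarrow> f a = 1"
      and "\<forall>t\<in>P. rk P t \<ge> 1 \<longrightarrow> degree (f t) \<le> (rk P t - 1) div 2" and "t \<in> P" for t
  proof (cases "rk P t = 0")
    case True
    then show ?thesis using assms that by (simp add: rk_eq_0_iff)
  next
    case False
    then have "degree (f t) \<le> (rk P t - 1) div 2" using that by simp
    then show ?thesis by linarith
  qed
  then show ?thesis
    using acceptable_lam_iff[of P f] by (auto simp: is_gamma_def)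
qed

lemma is_gamma_gam:
  assumes P: "eulerian P"
  shows "is_gamma P (gam P (lam P) :: 'a::order \<Rightarrow> 'k::field poly)"
    and "t \<notin> P \<Longrightarrow> gam P (lam P) t = (0 :: 'k poly)"
proof -
  have low: "lower_graded P" and loc: "locally_graded P" using P by (auto simp: eulerian_def)
  obtain f :: "'a \<Rightarrow> int poly" where "is_gamma P f" using is_gamma_exists_int[OF P] .
  then have g: "is_gamma P (\<lambda>t. map_poly of_int (f t) :: 'k poly)" by (rule is_gamma_of_int)
  \<comment> \<open>The recursion left the values off \<open>P\<close> free, whereas
    \<open>gam\<close> demands 0 there.\<close>
  define h where "h t = (if t \<in> P then map_poly of_int (f t) else 0 :: 'k poly)" for t
  have h: "is_gamma P h"
    unfolding is_gamma_def
  proof (intro conjI ballI allI impI)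
    fix t assume t: "t \<in> P"
    have "(\<Sum>s\<in>princ_ideal P t. h s * [:-1, 1:] ^ rk_int P s t) =
        (\<Sum>s\<in>princ_ideal P t. map_poly of_int (f s) * [:-1, 1:] ^ rk_int P s t)"
      by (intro sum.cong) (auto simp: h_def princ_ideal_def)
    then show "reflect_to (rk P t) (h t) = (\<Sum>s\<in>princ_ideal P t. h s * [:-1, 1:] ^ rk_int P s t)"
      using g t by (simp add: is_gamma_def h_def)
  qed (use g in \<open>auto simp: is_gamma_def h_def minimal_elt_def\<close>)
  have "gam P (lam P) = h"
    unfolding gam_def gam_conditions_iff[OF low]
  proof (rule the_equality)
    fix k :: "'a \<Rightarrow> 'k poly"
    assume k: "(\<forall>t. t \<notin> P \<longrightarrow> k t = 0) \<and> is_gamma P k"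
    then show "k = h"
      using is_gamma_unique[OF low loc _ h] by (auto simp: h_def fun_eq_iff)
  qed (use h in \<open>simp add: h_def\<close>)
  with h show "is_gamma P (gam P (lam P) :: 'a \<Rightarrow> 'k poly)"
    and "t \<notin> P \<Longrightarrow> gam P (lam P) t = (0 :: 'k poly)"
    by (simp_all add: h_def)
qed

text \<open>The conditions at \<open>t\<close> see only the principal ideal of \<open>t\<close>,
  which is the same in \<open>I\<close> and in \<open>P\<close>. Gamma of \<open>P\<close> therefore
  qualifies on \<open>I\<close>, and uniqueness applies.\<close>

lemma gam_order_ideal:
  assumes P: "eulerian P" and I: "order_ideal I P" and t: "t \<in> I"
  shows "gam I (lam I) t = (gam P (lam P) t :: 'k::field poly)"
proof (rule is_gamma_unique)
  have I': "eulerian I" using P I by (rule eulerian_order_ideal)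
  then show "lower_graded I" "locally_graded I" by (auto simp: eulerian_def)
  show "is_gamma I (gam I (lam I) :: _ \<Rightarrow> 'k poly)" by (rule is_gamma_gam(1)[OF I'])
  have "I \<subseteq> P" using I by (simp add: order_ideal_def)
  moreover have "is_gamma P (gam P (lam P) :: _ \<Rightarrow> 'k poly)" by (rule is_gamma_gam(1)[OF P])
  moreover have "minimal_elt I a \<Longrightarrow> minimal_elt P a" for a
    using minimal_elt_order_ideal[OF I, of a] by (auto simp: minimal_elt_def)
  ultimately show "is_gamma I (gam P (lam P) :: _ \<Rightarrow> 'k poly)"
    by (auto simp: is_gamma_def rk_order_ideal[OF I] princ_ideal_order_ideal[OF I]
        rk_int_order_ideal[OF I])
qed (rule t)

text \<open>With \<open>s\<close> fixed, total acceptability becomes acceptability on the principal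
  filter, whose only minimal element is \<open>s\<close>. The conditions on xi are thus those on
  gamma, one row at a time.\<close>

lemma xi_conditions_iff:
  fixes g :: "'a::order \<Rightarrow> 'a \<Rightarrow> 'k::field poly"
  assumes P: "eulerian P"
  shows "totally_acceptable P (lam P) g \<and> (\<forall>t\<in>P. g t t = 1) \<and>
      (\<forall>s\<in>P. \<forall>t\<in>P. s < t \<longrightarrow> degree (g s t) \<le> (rk_int P s t - 1) div 2) \<longleftrightarrow>
    g \<in> inc_alg P \<and> (\<forall>s\<in>P. is_gamma (princ_filter P s) (g s))"
proof -
  have loc: "locally_graded P" using P by (simp add: eulerian_def)
  have "is_gamma (princ_filter P s) (g s) \<longleftrightarrow>
      (\<forall>t\<in>P. s \<le> t \<longrightarrow> to_fract (inc_mult P g (lam P) s t) = bar (rk_int P s t) (g s t)) \<and>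
      g s s = 1 \<and> (\<forall>t\<in>P. s < t \<longrightarrow> degree (g s t) \<le> (rk_int P s t - 1) div 2)"
    if s: "s \<in> P" for s
  proof -
    let ?F = "princ_filter P s"
    have "lower_graded ?F" using eulerian_princ_filter[OF P s] by (simp add: eulerian_def)
    then have "is_gamma ?F (g s) \<longleftrightarrow> acceptable ?F (lam ?F) (g s) \<and> g s s = 1 \<and>
        (\<forall>t\<in>?F. rk_int P s t \<ge> 1 \<longrightarrow> degree (g s t) \<le> (rk_int P s t - 1) div 2)"
      by (subst gam_conditions_iff[symmetric]) (simp_all add: minimal_elt_princ_filter[OF s] rk_princ_filter)
    moreover have "(\<forall>t\<in>?F. rk_int P s t \<ge> 1 \<longrightarrow> degree (g s t) \<le> (rk_int P s t - 1) div 2) \<longleftrightarrow>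
        (\<forall>t\<in>P. s < t \<longrightarrow> degree (g s t) \<le> (rk_int P s t - 1) div 2)"
    proof -
      have "rk_int P s t \<ge> 1 \<and> s \<le> t \<longleftrightarrow> s < t" if "t \<in> P" for t
        using rk_int_pos[OF loc s that] s by (cases "s = t") auto
      then show ?thesis by (auto simp: princ_filter_def)
    qed
    moreover have "acceptable ?F (lam ?F) (g s) \<longleftrightarrow>
        (\<forall>t\<in>P. s \<le> t \<longrightarrow> to_fract (inc_mult P g (lam P) s t) = bar (rk_int P s t) (g s t))"
    proof -
      have "(\<Sum>r\<in>interval P s t. g s r * lam ?F r t) = inc_mult P g (lam P) s t"
        if t: "t \<in> P" "s \<le> t" for t
      proof -
        have "lam ?F r t = (lam P r t :: 'k poly)" if "r \<in> interval P s t" for r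
        proof -
          have "r \<in> ?F" using that by (simp add: interval_def princ_filter_def)
          then show ?thesis
            using that t by (simp add: lam_def rk_int_princ_filter) (simp add: princ_filter_def)
        qed
        then show ?thesis using s t by (simp add: inc_mult_def)
      qed
      then show ?thesis
        unfolding acceptable_def princ_ideal_princ_filter rk_princ_filter
        by (auto simp: princ_filter_def simp del: to_fract_sum to_fract_mult)
    qed
    ultimately show ?thesis by simp
  qed
  then show ?thesis
    unfolding totally_acceptable_def by (simp add: ball_conj_distrib del: to_fract_sum)
qed

text \<open>Existence and uniqueness of xi are inherited from gamma on the filters; the zero
  convention of \<open>gam\<close> supplies the zeros at \<open>t\<close> not above
  \<open>s\<close>.\<close>

lemma xi_eq_gam:
  assumes P: "eulerian P"
  shows "xi P (lam P) = (\<lambda>s t. if s \<in> P then gam (princ_filter P s) (lam (princ_filter P s)) t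
    else 0 :: 'k::field poly)"
    (is "_ = ?X")
  unfolding xi_def xi_conditions_iff[OF P]
proof (rule the_equality)
  have "t \<notin> princ_filter P s \<Longrightarrow> s \<in> P \<Longrightarrow> ?X s t = 0" for s t
    using is_gamma_gam(2)[OF eulerian_princ_filter[OF P]] by simp
  then show "?X \<in> inc_alg P \<and> (\<forall>s\<in>P. is_gamma (princ_filter P s) (?X s))"
    using is_gamma_gam(1)[OF eulerian_princ_filter[OF P]] by (auto simp: inc_alg_def princ_filter_def)
  fix g :: "_ \<Rightarrow> _ \<Rightarrow> 'k poly"
  assume g: "g \<in> inc_alg P \<and> (\<forall>s\<in>P. is_gamma (princ_filter P s) (g s))"
  show "g = ?X"
  proof (intro ext)
    fix s t
    consider "s \<notin> P" | "s \<in> P" "t \<notin> princ_filter P s" | "s \<in> P" "t \<in> princ_filter P s" by blast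
    then show "g s t = ?X s t"
    proof cases
      case 1
      then show ?thesis using g by (simp add: inc_alg_def)
    next
      case 2
      then have "g s t = 0" using g by (auto simp: inc_alg_def princ_filter_def)
      then show ?thesis using 2 is_gamma_gam(2)[OF eulerian_princ_filter[OF P]] by simp
    next
      case 3
      let ?F = "princ_filter P s"
      have "eulerian ?F" using P 3 by (simp add: eulerian_princ_filter)
      then have "g s t = gam ?F (lam ?F) t"
        using 3 g by (intro is_gamma_unique[of ?F] is_gamma_gam) (auto simp: eulerian_def)
      then show ?thesis using 3 by simp
    qed
  qed
qed

lemma xi_inc_unit:
  assumes P: "eulerian P"
  shows "inc_unit P (xi P (lam P) :: 'a::order \<Rightarrow> 'a \<Rightarrow> 'k::field poly)"
  unfolding inc_unit_def inc_alg_def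
proof (intro conjI ballI CollectI allI impI)
  fix s t assume "\<not> (s \<in> P \<and> t \<in> P \<and> s \<le> t)"
  then consider "s \<notin> P" | "s \<in> P" "t \<notin> princ_filter P s" by (auto simp: princ_filter_def)
  then show "xi P (lam P) s t = (0 :: 'k poly)"
    by cases (simp_all add: xi_eq_gam[OF P] is_gamma_gam(2)[OF eulerian_princ_filter[OF P]])
next
  fix t assume t: "t \<in> P"
  have "is_gamma (princ_filter P t) (gam (princ_filter P t) (lam (princ_filter P t)) :: _ \<Rightarrow> 'k poly)"
    by (rule is_gamma_gam(1)[OF eulerian_princ_filter[OF P t]])
  then show "xi P (lam P) t t = (1 :: 'k poly)"
    using t minimal_elt_princ_filter[OF t, of t] by (simp add: is_gamma_def xi_eq_gam[OF P])
qed

lemma xi_properties: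
  assumes P: "eulerian P" and st: "s \<in> P" "t \<in> P" "s \<le> t"
  shows "degree (xi P (lam P) s t :: 'k::field poly) \<le> rk_int P s t"
    and "reflect_to (rk_int P s t) (xi P (lam P) s t :: 'k poly) =
      (\<Sum>r\<in>interval P s t. xi P (lam P) s r * [:-1, 1:] ^ rk_int P r t)"
proof -
  let ?F = "princ_filter P s"
  have F: "eulerian ?F" and low: "lower_graded ?F"
    using eulerian_princ_filter[OF P st(1)] by (auto simp: eulerian_def)
  have g: "is_gamma ?F (gam ?F (lam ?F) :: _ \<Rightarrow> 'k poly)" by (rule is_gamma_gam(1)[OF F])
  have t: "t \<in> ?F" using st by (simp add: princ_filter_def)
  show "degree (xi P (lam P) s t :: 'k poly) \<le> rk_int P s t"
    using is_gamma_degree[OF low g t] st by (simp add: xi_eq_gam[OF P] rk_princ_filter)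
  have "reflect_to (rk_int P s t) (gam ?F (lam ?F) t :: 'k poly) =
      (\<Sum>r\<in>interval P s t. gam ?F (lam ?F) r * [:-1, 1:] ^ rk_int ?F r t)"
    using g t by (simp add: is_gamma_def rk_princ_filter princ_ideal_princ_filter)
  also have "\<dots> = (\<Sum>r\<in>interval P s t. gam ?F (lam ?F) r * [:-1, 1:] ^ rk_int P r t)"
  proof (rule sum.cong[OF refl])
    fix r assume "r \<in> interval P s t"
    then have "r \<in> ?F" by (auto simp: interval_def princ_filter_def)
    then show "gam ?F (lam ?F) r * [:-1, 1:] ^ rk_int ?F r t =
        (gam ?F (lam ?F) r * [:-1, 1:] ^ rk_int P r t :: 'k poly)"
      by (simp only: rk_int_princ_filter)
  qed
  finally show "reflect_to (rk_int P s t) (xi P (lam P) s t :: 'k poly) =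
      (\<Sum>r\<in>interval P s t. xi P (lam P) s r * [:-1, 1:] ^ rk_int P r t)"
    using st by (simp add: xi_eq_gam[OF P])
qed

text \<open>The filter at \<open>s\<close> within \<open>I\<close> is an order ideal of the filter
  at \<open>s\<close> within \<open>P\<close>, which reduces the claim to
  \<open>gam_order_ideal\<close>.\<close>

lemma xi_order_ideal:
  assumes P: "eulerian P" and I: "order_ideal I P" and st: "s \<in> I" "t \<in> I"
  shows "xi I (lam I) s t = (xi P (lam P) s t :: 'k::field poly)"
proof -
  have s: "s \<in> P" using I st by (auto simp: order_ideal_def)
  have xiI: "xi I (lam I) s t = (gam (princ_filter I s) (lam (princ_filter I s)) t :: 'k poly)"
    using st by (simp add: xi_eq_gam[OF eulerian_order_ideal[OF P I]])
  have F: "order_ideal (princ_filter I s) (princ_filter P s)"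
    using I by (auto simp: order_ideal_def princ_filter_def)
  show ?thesis
  proof (cases "s \<le> t")
    case True
    then have "t \<in> princ_filter I s" using st by (simp add: princ_filter_def)
    then show ?thesis
      using gam_order_ideal[OF eulerian_princ_filter[OF P s] F] xiI s by (simp add: xi_eq_gam[OF P])
  next
    case False
    then show ?thesis
      using xi_inc_unit[OF P, where ?'k = 'k] xi_inc_unit[OF eulerian_order_ideal[OF P I], where ?'k = 'k]
      by (auto simp: inc_unit_def inc_alg_def)
  qed
qed

section \<open>Polynomials h and local h\<close>

text \<open>The degree of gamma at \<open>t\<close> is at most the rank, so the sum has degree at
  most \<open>d\<close> and its reflection solves the defining equation; \<open>bar_inject\<close>
  makes that solution unique.\<close>

lemma h_part_reflect:
  fixes R :: "'a::order set"
  assumes R: "eulerian R" and S: "S \<subseteq> R" "finite S" and d: "\<And>t. t \<in> S \<Longrightarrow> rk R t \<le> d"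
  shows "degree (h_part d R S :: 'k::field poly) \<le> d"
    and "reflect_to d (h_part d R S :: 'k poly) =
      (\<Sum>t\<in>S. gam R (lam R) t * [:-1, 1:] ^ (d - rk R t))"
proof -
  let ?q = "\<Sum>t\<in>S. gam R (lam R) t * [:-1, 1:] ^ (d - rk R t) :: 'k poly"
  have low: "lower_graded R" using R by (simp add: eulerian_def)
  have q: "degree ?q \<le> d"
  proof (intro degree_sum_le S)
    fix t assume t: "t \<in> S"
    then have "degree (gam R (lam R) t :: 'k poly) \<le> rk R t"
      using S by (intro is_gamma_degree[OF low is_gamma_gam(1)[OF R]]) auto
    then show "degree (gam R (lam R) t * [:-1, 1:] ^ (d - rk R t) :: 'k poly) \<le> d"
      using d[OF t] by (intro degree_mult_linear_power_le) auto
  qed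
  have "h_part d R S = reflect_to d ?q"
    unfolding h_part_def
  proof (rule the_equality)
    show bar: "bar d (reflect_to d ?q) = to_fract ?q"
      unfolding bar_eq_reflect_to[OF degree_reflect_to] reflect_to_involution[OF q] ..
    fix p assume "bar d p = to_fract ?q"
    then have "bar d p = bar d (reflect_to d ?q)" unfolding bar .
    then show "p = reflect_to d ?q" by (rule bar_inject)
  qed
  then show "degree (h_part d R S :: 'k poly) \<le> d" "reflect_to d (h_part d R S :: 'k poly) = ?q"
    using degree_reflect_to[of d ?q] reflect_to_involution[OF q] by simp_all
qed

text \<open>The product of \<open>f\<close> with the inverse of xi. For f_u = h(Q_u, x) it is the
  local h-polynomial over the principal ideal of \<open>u\<close>.\<close>

definition xi_coeff :: "'a::order set \<Rightarrow> ('a \<Rightarrow> 'k::field poly) \<Rightarrow> 'a \<Rightarrow> 'k poly" where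
  "xi_coeff P f u = (\<Sum>v\<in>princ_ideal P u. f v * inc_inv P (xi P (lam P)) v u)"

lemma xi_coeff_expansion:
  fixes f :: "'a::order \<Rightarrow> 'k::field poly"
  assumes P: "eulerian P" and u: "u \<in> P"
  shows "f u = (\<Sum>v\<in>princ_ideal P u. xi_coeff P f v * xi P (lam P) v u)"
proof -
  have low: "lower_graded P" and loc: "locally_graded P" using P by (auto simp: eulerian_def)
  let ?x = "xi P (lam P) :: 'a \<Rightarrow> 'a \<Rightarrow> 'k poly" and ?y = "inc_inv P (xi P (lam P)) :: 'a \<Rightarrow> 'a \<Rightarrow> 'k poly"
  have "(\<Sum>v\<in>princ_ideal P u. xi_coeff P f v * ?x v u) =
      (\<Sum>v\<in>princ_ideal P u. \<Sum>w\<in>princ_ideal P v. f w * ?y w v * ?x v u)"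
    by (simp add: xi_coeff_def sum_distrib_right)
  also have "\<dots> = (\<Sum>w\<in>princ_ideal P u. \<Sum>v\<in>interval P w u. f w * ?y w v * ?x v u)"
    by (rule sum_princ_ideal_interval_swap[OF low loc u])
  also have "\<dots> = (\<Sum>w\<in>princ_ideal P u. if w = u then f u else 0)"
  proof (rule sum.cong[OF refl])
    fix w assume w: "w \<in> princ_ideal P u"
    have "(\<Sum>v\<in>interval P w u. f w * ?y w v * ?x v u) = f w * inc_mult P ?y ?x w u"
      using w u by (simp add: inc_mult_def princ_ideal_def sum_distrib_left mult.assoc)
    also have "\<dots> = (if w = u then f u else 0)"
      using u by (simp add: inc_inv(3)[OF loc xi_inc_unit[OF P]] inc_one_def)
    finally show "(\<Sum>v\<in>interval P w u. f w * ?y w v * ?x v u) = (if w = u then f u else 0)" .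
  qed
  also have "\<dots> = f u"
    using finite_princ_ideal[OF low u] u by (subst sum.delta) (simp_all add: princ_ideal_def)
  finally show ?thesis by simp
qed

text \<open>Two evaluations of the reflected \<open>f u\<close> agree except in the term of
  \<open>u\<close>, where one has the reflected coefficient and the other the coefficient itself.
  The degree bound joins the induction because reflecting products requires it.\<close>

lemma xi_coeff_symmetric:
  fixes f :: "'a::order \<Rightarrow> 'k::field poly"
  assumes P: "eulerian P" and deg: "\<And>u. u \<in> P \<Longrightarrow> degree (f u) \<le> rk P u"
    and acc: "\<And>u. u \<in> P \<Longrightarrow>
      reflect_to (rk P u) (f u) = (\<Sum>v\<in>princ_ideal P u. f v * [:-1, 1:] ^ rk_int P v u)"
    and "u \<in> P"
  shows "degree (xi_coeff P f u) \<le> rk P u \<and> reflect_to (rk P u) (xi_coeff P f u) = xi_coeff P f u"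
  using \<open>u \<in> P\<close>
proof (induction "rk P u" arbitrary: u rule: less_induct)
  case less
  note u = less.prems
  have low: "lower_graded P" and loc: "locally_graded P" using P by (auto simp: eulerian_def)
  let ?x = "xi P (lam P) :: 'a \<Rightarrow> 'a \<Rightarrow> 'k poly" and ?L = "xi_coeff P f"
  have below: "v \<in> P" "v \<le> u" "rk P v + rk_int P v u = rk P u"
      "degree (?L v) \<le> rk P v" "reflect_to (rk P v) (?L v) = ?L v"
    if "v \<in> princ_ideal P u - {u}" for v
  proof -
    show v: "v \<in> P" "v \<le> u" using that by (auto simp: princ_ideal_def)
    then show "rk P v + rk_int P v u = rk P u" using u by (intro rk_add[OF low])
    have "rk P v < rk P u" using that v u by (intro rk_less[OF low loc]) auto
    then show "degree (?L v) \<le> rk P v" "reflect_to (rk P v) (?L v) = ?L v"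
      using less.hyps v by blast+
  qed
  have xuu: "?x u u = 1" using xi_inc_unit[OF P] u by (auto simp: inc_unit_def)
  have f: "f u = ?L u + (\<Sum>v\<in>princ_ideal P u - {u}. ?L v * ?x v u)"
    using xi_coeff_expansion[OF P u, of f] princ_ideal_sum_remove[OF low u, of "\<lambda>v. ?L v * ?x v u"] xuu
    by simp
  have "degree (\<Sum>v\<in>princ_ideal P u - {u}. ?L v * ?x v u) \<le> rk P u"
  proof (intro degree_sum_le finite_Diff finite_princ_ideal[OF low u])
    fix v assume v: "v \<in> princ_ideal P u - {u}"
    have "degree (?L v * ?x v u) \<le> degree (?L v) + degree (?x v u)" by (rule degree_mult_le)
    then show "degree (?L v * ?x v u) \<le> rk P u"
      using below[OF v] xi_properties(1)[OF P, of v u, where ?'k = 'k] u by linarith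
  qed
  then have degL: "degree (?L u) \<le> rk P u"
    using degree_diff_le[OF deg[OF u]] f by (metis add_diff_cancel_right')
  \<comment> \<open>First evaluation: the expansion of \<open>f u\<close> is reflected term by term,
    with the induction hypothesis below \<open>u\<close>.\<close>
  have "reflect_to (rk P u) (f u) =
      reflect_to (rk P u) (?L u) + (\<Sum>v\<in>princ_ideal P u - {u}. reflect_to (rk P u) (?L v * ?x v u))"
    by (subst f) (simp only: reflect_to_add reflect_to_sum)
  also have "(\<Sum>v\<in>princ_ideal P u - {u}. reflect_to (rk P u) (?L v * ?x v u)) =
      (\<Sum>v\<in>princ_ideal P u - {u}. ?L v * reflect_to (rk_int P v u) (?x v u))"
  proof (rule sum.cong[OF refl])
    fix v assume v: "v \<in> princ_ideal P u - {u}"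
    have "reflect_to (rk P v + rk_int P v u) (?L v * ?x v u) =
        reflect_to (rk P v) (?L v) * reflect_to (rk_int P v u) (?x v u)"
      using below[OF v] u by (intro reflect_to_mult xi_properties(1)[OF P])
    then show "reflect_to (rk P u) (?L v * ?x v u) = ?L v * reflect_to (rk_int P v u) (?x v u)"
      using below[OF v] by simp
  qed
  finally have 1: "reflect_to (rk P u) (f u) = reflect_to (rk P u) (?L u) +
      (\<Sum>v\<in>princ_ideal P u - {u}. ?L v * reflect_to (rk_int P v u) (?x v u))" .
  \<comment> \<open>Second evaluation: acceptability of \<open>f\<close>, then xi lambda rewritten
    as reflected xi.\<close>
  have "reflect_to (rk P u) (f u) = (\<Sum>w\<in>princ_ideal P u. f w * [:-1, 1:] ^ rk_int P w u)"
    by (rule acc[OF u])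
  also have "\<dots> = (\<Sum>w\<in>princ_ideal P u. \<Sum>v\<in>princ_ideal P w. ?L v * ?x v w * [:-1, 1:] ^ rk_int P w u)"
  proof (rule sum.cong[OF refl])
    fix w assume "w \<in> princ_ideal P u"
    then have "w \<in> P" by (simp add: princ_ideal_def)
    then show "f w * [:-1, 1:] ^ rk_int P w u =
        (\<Sum>v\<in>princ_ideal P w. ?L v * ?x v w * [:-1, 1:] ^ rk_int P w u)"
      by (subst xi_coeff_expansion[OF P, of w f]) (simp_all only: sum_distrib_right)
  qed
  also have "\<dots> = (\<Sum>v\<in>princ_ideal P u. \<Sum>w\<in>interval P v u. ?L v * ?x v w * [:-1, 1:] ^ rk_int P w u)"
    by (rule sum_princ_ideal_interval_swap[OF low loc u])
  also have "\<dots> = (\<Sum>v\<in>princ_ideal P u. ?L v * reflect_to (rk_int P v u) (?x v u))"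
  proof (rule sum.cong[OF refl])
    fix v assume "v \<in> princ_ideal P u"
    then have v: "v \<in> P" "v \<le> u" by (auto simp: princ_ideal_def)
    show "(\<Sum>w\<in>interval P v u. ?L v * ?x v w * [:-1, 1:] ^ rk_int P w u) =
        ?L v * reflect_to (rk_int P v u) (?x v u)"
      unfolding xi_properties(2)[OF P v(1) u v(2)] by (simp only: sum_distrib_left mult.assoc)
  qed
  also have "\<dots> = ?L u + (\<Sum>v\<in>princ_ideal P u - {u}. ?L v * reflect_to (rk_int P v u) (?x v u))"
    by (subst princ_ideal_sum_remove[OF low u]) (simp add: u xuu reflect_to_one)
  finally have 2: "reflect_to (rk P u) (f u) =
      ?L u + (\<Sum>v\<in>princ_ideal P u - {u}. ?L v * reflect_to (rk_int P v u) (?x v u))" .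
  from 1 2 degL show ?case by simp
qed

section \<open>Formal subdivisions\<close>

text \<open>Since Q_u is an order ideal, its gamma and ranks are those of \<open>Q\<close>. The
  third formula is condition (iii) after reflection.\<close>

lemma subdivision_h_poly:
  fixes P :: "'p::order set" and Q :: "'q::order set" and \<sigma> :: "'q \<Rightarrow> 'p"
  assumes P: "lower_graded P" and sub: "formal_subdivision TYPE('k::field) P Q \<sigma>" and u: "u \<in> P"
  shows "degree (h_poly (sub_below P Q \<sigma> u) :: 'k poly) \<le> rk P u"
    and "reflect_to (rk P u) (h_poly (sub_below P Q \<sigma> u) :: 'k poly) =
      (\<Sum>t\<in>sub_below P Q \<sigma> u. gam Q (lam Q) t * [:-1, 1:] ^ (rk P u - rk Q t))"
    and "(h_poly (sub_below P Q \<sigma> u) :: 'k poly) =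
      (\<Sum>t\<in>sub_int Q \<sigma> u. gam Q (lam Q) t * [:-1, 1:] ^ (rk P u - rk Q t))"
proof -
  let ?I = "sub_below P Q \<sigma> u"
  let ?f = "h_poly ?I :: 'k poly"
  have Q: "eulerian Q"
    using sub by (intro eulerian_if_locally_Eulerian) (auto simp: formal_subdivision_def)
  have I: "order_ideal ?I Q" and fin: "finite ?I" and len: "poset_length ?I = rk P u"
    and bar: "bar (rk P u) ?f = to_fract (h_part (rk P u) Q (sub_int Q \<sigma> u))"
    using sub u by (auto simp: formal_subdivision_def)
  have EI: "eulerian ?I" by (rule eulerian_order_ideal[OF Q I])
  have rkQ: "rk Q t \<le> rk P u" if "t \<in> ?I" for t
  proof -
    have "rk P (\<sigma> t) \<le> rk P u"
      using that u rk_add[OF P, of "\<sigma> t" u] by (auto simp: sub_below_def princ_ideal_def)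
    moreover have "rk Q t \<le> rk P (\<sigma> t)"
      using sub that by (auto simp: formal_subdivision_def sub_below_def)
    ultimately show ?thesis by simp
  qed
  have f: "?f = h_part (rk P u) ?I ?I" by (simp add: h_poly_def len)
  have rkI: "rk ?I t \<le> rk P u" if "t \<in> ?I" for t
    using that rkQ by (simp add: rk_order_ideal[OF I])
  show deg: "degree ?f \<le> rk P u"
    unfolding f by (rule h_part_reflect(1)[OF EI order_refl fin rkI])
  have "reflect_to (rk P u) ?f = (\<Sum>t\<in>?I. gam ?I (lam ?I) t * [:-1, 1:] ^ (rk P u - rk ?I t))"
    unfolding f by (rule h_part_reflect(2)[OF EI order_refl fin rkI])
  also have "\<dots> = (\<Sum>t\<in>?I. gam Q (lam Q) t * [:-1, 1:] ^ (rk P u - rk Q t))"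
    by (rule sum.cong[OF refl]) (simp only: gam_order_ideal[OF Q I] rk_order_ideal[OF I])
  finally show "reflect_to (rk P u) ?f =
      (\<Sum>t\<in>?I. gam Q (lam Q) t * [:-1, 1:] ^ (rk P u - rk Q t))" .
  have int: "sub_int Q \<sigma> u \<subseteq> ?I" using u by (auto simp: sub_int_def sub_below_def princ_ideal_def)
  have int_Q: "sub_int Q \<sigma> u \<subseteq> Q" by (auto simp: sub_int_def)
  have int_fin: "finite (sub_int Q \<sigma> u)" using int fin by (rule finite_subset)
  have int_rk: "rk Q t \<le> rk P u" if "t \<in> sub_int Q \<sigma> u" for t using that int rkQ by blast
  \<comment> \<open>The degree bound makes \<open>bar\<close> a polynomial, so condition (iii)
    becomes an equation in K[x], and a second reflection turns its right side into the sum over the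
    fibre.\<close>
  have "reflect_to (rk P u) ?f = h_part (rk P u) Q (sub_int Q \<sigma> u)"
    using bar unfolding bar_eq_reflect_to[OF deg] to_fract_eq_iff .
  then have "?f = reflect_to (rk P u) (h_part (rk P u) Q (sub_int Q \<sigma> u))"
    using reflect_to_involution[OF deg] by simp
  also have "\<dots> = (\<Sum>t\<in>sub_int Q \<sigma> u. gam Q (lam Q) t * [:-1, 1:] ^ (rk P u - rk Q t))"
    by (rule h_part_reflect(2)[OF Q int_Q int_fin int_rk])
  finally show "?f = (\<Sum>t\<in>sub_int Q \<sigma> u. gam Q (lam Q) t * [:-1, 1:] ^ (rk P u - rk Q t))" .
qed

text \<open>
  Regroups a sum over the faces of the subdivision by their carriers; by condition (iii) the faces
  with carrier \<open>u\<close> contribute exactly \<open>h(Q\<^sub>u, x)\<close>.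
\<close>

lemma subdivision_sum_by_carrier:
  fixes P :: "'p::order set" and Q :: "'q::order set" and \<sigma> :: "'q \<Rightarrow> 'p"
  assumes P: "lower_graded P" and sub: "formal_subdivision TYPE('k::field) P Q \<sigma>"
    and A: "A \<subseteq> P" "finite A" and fin: "finite {t \<in> Q. \<sigma> t \<in> A}"
    and d: "\<And>u. u \<in> A \<Longrightarrow> rk P u \<le> d"
  shows "(\<Sum>u\<in>A. h_poly (sub_below P Q \<sigma> u) * [:-1, 1:] ^ (d - rk P u)) =
    (\<Sum>t | t \<in> Q \<and> \<sigma> t \<in> A. gam Q (lam Q) t * [:-1, 1:] ^ (d - rk Q t) :: 'k poly)"
proof -
  let ?g = "\<lambda>t. gam Q (lam Q) t * [:-1, 1:] ^ (d - rk Q t) :: 'k poly"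
  have "h_poly (sub_below P Q \<sigma> u) * [:-1, 1:] ^ (d - rk P u) =
      (\<Sum>t | t \<in> {t \<in> Q. \<sigma> t \<in> A} \<and> \<sigma> t = u. ?g t)" if u: "u \<in> A" for u
  proof -
    have "{t. t \<in> {t \<in> Q. \<sigma> t \<in> A} \<and> \<sigma> t = u} = sub_int Q \<sigma> u"
      using u by (auto simp: sub_int_def)
    moreover have "(\<Sum>t\<in>sub_int Q \<sigma> u. gam Q (lam Q) t * [:-1, 1:] ^ (rk P u - rk Q t)) *
        [:-1, 1:] ^ (d - rk P u) = (\<Sum>t\<in>sub_int Q \<sigma> u. ?g t)"
      unfolding sum_distrib_right
    proof (rule sum.cong[OF refl])
      fix t assume t: "t \<in> sub_int Q \<sigma> u"
      have "rk Q t \<le> rk P u" using sub t by (auto simp: formal_subdivision_def sub_int_def)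
      \<comment> \<open>Truncated subtraction is harmless: the rank of \<open>t\<close> is at most
        that of its carrier \<open>u\<close>, which is at most \<open>d\<close>.\<close>
      then have "d - rk Q t = (rk P u - rk Q t) + (d - rk P u)" using d[OF u] by simp
      then show "gam Q (lam Q) t * [:-1, 1:] ^ (rk P u - rk Q t) * [:-1, 1:] ^ (d - rk P u) = ?g t"
        by (simp only: power_add mult.assoc)
    qed
    moreover have "u \<in> P" using u A by blast
    ultimately show ?thesis
      by (simp only: subdivision_h_poly(3)[OF P sub])
  qed
  then have "(\<Sum>u\<in>A. h_poly (sub_below P Q \<sigma> u) * [:-1, 1:] ^ (d - rk P u)) =
      (\<Sum>u\<in>A. \<Sum>t | t \<in> {t \<in> Q. \<sigma> t \<in> A} \<and> \<sigma> t = u. ?g t)"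
    by (rule sum.cong[OF refl])
  also have "\<dots> = sum ?g {t \<in> Q. \<sigma> t \<in> A}"
    using A fin by (intro sum.group) auto
  finally show ?thesis .
qed

text \<open>Q_u consists of the faces carried by the principal ideal of \<open>u\<close>, so
  regrouping by carriers applies to the sum defining the reflected h(Q_u, x).\<close>

lemma subdivision_h_acceptable:
  fixes P :: "'p::order set" and Q :: "'q::order set" and \<sigma> :: "'q \<Rightarrow> 'p"
  assumes P: "lower_graded P" and sub: "formal_subdivision TYPE('k::field) P Q \<sigma>" and u: "u \<in> P"
  shows "reflect_to (rk P u) (h_poly (sub_below P Q \<sigma> u) :: 'k poly) =
    (\<Sum>v\<in>princ_ideal P u. h_poly (sub_below P Q \<sigma> v) * [:-1, 1:] ^ rk_int P v u)"
proof -
  have rk: "rk P v + rk_int P v u = rk P u" if "v \<in> princ_ideal P u" for v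
    using that u by (intro rk_add[OF P]) (auto simp: princ_ideal_def)
  have "finite {t \<in> Q. \<sigma> t \<in> princ_ideal P u}"
    using sub u by (simp add: formal_subdivision_def sub_below_def)
  then have "(\<Sum>v\<in>princ_ideal P u. h_poly (sub_below P Q \<sigma> v) * [:-1, 1:] ^ (rk P u - rk P v)) =
      (\<Sum>t | t \<in> Q \<and> \<sigma> t \<in> princ_ideal P u. gam Q (lam Q) t * [:-1, 1:] ^ (rk P u - rk Q t) :: 'k poly)"
  proof (intro subdivision_sum_by_carrier[OF P sub] finite_princ_ideal[OF P u])
    show "rk P v \<le> rk P u" if "v \<in> princ_ideal P u" for v using rk[OF that] by simp
  qed (auto simp: princ_ideal_def)
  also have "\<dots> = reflect_to (rk P u) (h_poly (sub_below P Q \<sigma> u))"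
    unfolding subdivision_h_poly(2)[OF P sub u] by (simp add: sub_below_def)
  finally have "reflect_to (rk P u) (h_poly (sub_below P Q \<sigma> u) :: 'k poly) =
      (\<Sum>v\<in>princ_ideal P u. h_poly (sub_below P Q \<sigma> v) * [:-1, 1:] ^ (rk P u - rk P v))" by simp
  also have "\<dots> = (\<Sum>v\<in>princ_ideal P u. h_poly (sub_below P Q \<sigma> v) * [:-1, 1:] ^ rk_int P v u)"
  proof (rule sum.cong[OF refl])
    fix v assume "v \<in> princ_ideal P u"
    then have "rk P u - rk P v = rk_int P v u" using rk by fastforce
    then show "h_poly (sub_below P Q \<sigma> v) * [:-1, 1:] ^ (rk P u - rk P v) =
        (h_poly (sub_below P Q \<sigma> v) * [:-1, 1:] ^ rk_int P v u :: 'k poly)" by (simp only:)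
  qed
  finally show ?thesis .
qed

text \<open>The principal ideal is convex in \<open>P\<close>, so xi and its inverse restrict to it;
  below \<open>u\<close>, the sets Q_v formed inside Q_u are those formed inside
  \<open>Q\<close>.\<close>

lemma local_h_princ_ideal:
  assumes P: "eulerian P" and u: "u \<in> P"
  shows "local_h (princ_ideal P u) (sub_below P Q \<sigma> u) \<sigma> =
    (xi_coeff P (\<lambda>v. h_poly (sub_below P Q \<sigma> v)) u :: 'k::field poly)"
proof -
  let ?I = "princ_ideal P u"
  have I: "order_ideal ?I P" by (rule order_ideal_princ_ideal)
  have uI: "u \<in> ?I" using u by (simp add: princ_ideal_def)
  have loc: "locally_graded P" "locally_graded ?I"
    using P eulerian_order_ideal[OF P I] by (auto simp: eulerian_def)
  have max: "(THE m. maximum_elt ?I m) = u"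
    by (rule the_equality) (use u in \<open>auto simp: maximum_elt_def princ_ideal_def intro: antisym\<close>)
  have "inc_inv ?I (xi ?I (lam ?I)) v u = (inc_inv P (xi P (lam P)) v u :: 'k poly)" if "v \<in> ?I" for v
    by (rule inc_inv_convex_subset[OF loc(1) xi_inc_unit[OF P] _ loc(2) _ _ that uI])
      (auto simp: interval_order_ideal[OF I] xi_order_ideal[OF P I], simp add: princ_ideal_def)
  moreover have "sub_below ?I (sub_below P Q \<sigma> u) \<sigma> v = sub_below P Q \<sigma> v" if "v \<in> ?I" for v
    using that by (auto simp: sub_below_def princ_ideal_def)
  ultimately show ?thesis
    unfolding local_h_def xi_coeff_def max by (intro sum.cong) auto
qed

section \<open>The h-polynomial over a finite graded poset\<close>

lemma graded_rank_eq:
  assumes "graded_of_rank P d" and "v \<in> P"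
  shows "rk P v + poset_length (princ_filter P v) = d"
  using graded_split(3)[OF assms] by (simp add: rk_def princ_ideal_def princ_filter_def)

text \<open>A chain lies below its top element \<open>t\<close>, whose rank is at most that of its
  carrier and hence at most \<open>d\<close>. Conversely a maximal element of \<open>P\<close> has
  rank \<open>d\<close>, and the part of \<open>Q\<close> above its principal ideal has length
  \<open>d\<close>.\<close>

lemma poset_length_subdivision:
  assumes sub: "formal_subdivision TYPE('k::field) P Q \<sigma>" and P: "graded_of_rank P d" and "P \<noteq> {}"
    and fin: "finite Q"
  shows "poset_length Q = d"
proof (rule antisym)
  have finP: "finite P" using P by (simp add: graded_of_rank_def)
  have rkP: "rk P u \<le> d" if "u \<in> P" for u using graded_rank_eq[OF P that] by simp
  show "poset_length Q \<le> d"
  proof (rule poset_length_le[OF fin])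
    fix C assume C: "pred_on.chain Q (<) C"
    then have "finite C" using fin by (auto simp: less_chain_iff intro: finite_subset)
    show "card C - 1 \<le> d"
    proof (cases "C = {}")
      case False
      then obtain t where t: "t \<in> C" "\<forall>s\<in>C. t \<le> s \<longrightarrow> t = s"
        using finite_has_maximal[OF \<open>finite C\<close>] by blast
      then have "pred_on.chain (princ_ideal Q t) (<) C"
        using C by (auto simp: less_chain_iff princ_ideal_def)
      then have "card C - 1 \<le> rk Q t"
        unfolding rk_def using fin by (intro poset_length_ge) (auto simp: princ_ideal_def)
      moreover have "t \<in> Q" using t C by (auto simp: less_chain_iff)
      moreover have "rk Q t \<le> rk P (\<sigma> t)" "\<sigma> t \<in> P"
        using sub \<open>t \<in> Q\<close> by (auto simp: formal_subdivision_def)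
      ultimately show ?thesis using rkP[of "\<sigma> t"] by linarith
    qed simp
  qed
  obtain m where m: "m \<in> P" "\<forall>s\<in>P. m \<le> s \<longrightarrow> m = s"
    using finite_has_maximal[OF finP \<open>P \<noteq> {}\<close>] by blast
  then have "princ_filter P m = {m}" by (auto simp: princ_filter_def)
  then have "rk P m = d" using graded_rank_eq[OF P m(1)] by (simp add: poset_length_singleton)
  moreover have "poset_length (sub_below P Q \<sigma> m) = rk P m"
    using sub m by (auto simp: formal_subdivision_def)
  moreover have "poset_length (sub_below P Q \<sigma> m) \<le> poset_length Q"
    using fin by (intro poset_length_mono) (auto simp: sub_below_def)
  ultimately show "d \<le> poset_length Q" by simp
qed

text \<open>Gamma on the filter at \<open>v\<close> is the row of xi at \<open>v\<close>. Since the
  filter has length d - rho(v), the exponents simplify to d - rho(u).\<close>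

lemma h_poly_princ_filter:
  assumes P: "eulerian P" and d: "graded_of_rank P d" and v: "v \<in> P"
  shows "degree (h_poly (princ_filter P v) :: 'k::field poly) \<le> d - rk P v"
    and "reflect_to (d - rk P v) (h_poly (princ_filter P v) :: 'k poly) =
      (\<Sum>u\<in>princ_filter P v. xi P (lam P) v u * [:-1, 1:] ^ (d - rk P u))"
proof -
  let ?F = "princ_filter P v"
  have low: "lower_graded P" using P by (simp add: eulerian_def)
  have F: "eulerian ?F" by (rule eulerian_princ_filter[OF P v])
  have "finite P" using d by (simp add: graded_of_rank_def)
  then have fin: "finite ?F" by (simp add: princ_filter_def)
  have h: "(h_poly ?F :: 'k poly) = h_part (d - rk P v) ?F ?F"
    using graded_rank_eq[OF d v] by (simp add: h_poly_def flip: graded_rank_eq[OF d v])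
  have u: "rk P v + rk ?F u = rk P u \<and> rk P u \<le> d" if "u \<in> ?F" for u
    using that v rk_add[OF low, of v u] graded_rank_eq[OF d, of u]
    by (auto simp: princ_filter_def rk_princ_filter[unfolded princ_filter_def])
  then have rkF: "rk ?F u \<le> d - rk P v" if "u \<in> ?F" for u using that by fastforce
  show "degree (h_poly ?F :: 'k poly) \<le> d - rk P v"
    unfolding h by (rule h_part_reflect(1)[OF F order_refl fin rkF])
  have "reflect_to (d - rk P v) (h_poly ?F :: 'k poly) =
      (\<Sum>u\<in>?F. gam ?F (lam ?F) u * [:-1, 1:] ^ (d - rk P v - rk ?F u))"
    unfolding h by (rule h_part_reflect(2)[OF F order_refl fin rkF])
  also have "\<dots> = (\<Sum>u\<in>?F. xi P (lam P) v u * [:-1, 1:] ^ (d - rk P u))"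
  proof (rule sum.cong[OF refl])
    fix w assume "w \<in> ?F"
    then have "d - rk P v - rk ?F w = d - rk P w" using u by fastforce
    moreover have "gam ?F (lam ?F) w = (xi P (lam P) v w :: 'k poly)" using v by (simp add: xi_eq_gam[OF P])
    ultimately show "gam ?F (lam ?F) w * [:-1, 1:] ^ (d - rk P v - rk ?F w) =
        (xi P (lam P) v w * [:-1, 1:] ^ (d - rk P w) :: 'k poly)" by (simp only:)
  qed
  finally show "reflect_to (d - rk P v) (h_poly ?F :: 'k poly) =
      (\<Sum>u\<in>?F. xi P (lam P) v u * [:-1, 1:] ^ (d - rk P u))" .
qed

text \<open>Both sides have degree at most \<open>d\<close>, so it suffices to compare their
  reflections.\<close>

lemma subdivision_h_poly_decomposition:
  fixes P :: "'p::order set" and Q :: "'q::order set" and \<sigma> :: "'q \<Rightarrow> 'p"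
  assumes P: "eulerian P" and sub: "formal_subdivision TYPE('k::field) P Q \<sigma>"
    and d: "graded_of_rank P d"
  shows "(h_poly Q :: 'k poly) =
    (\<Sum>u\<in>P. xi_coeff P (\<lambda>v. h_poly (sub_below P Q \<sigma> v)) u * h_poly (princ_filter P u))"
proof -
  let ?f = "\<lambda>v. h_poly (sub_below P Q \<sigma> v) :: 'k poly"
  let ?L = "xi_coeff P ?f"
  let ?x = "xi P (lam P) :: 'p \<Rightarrow> 'p \<Rightarrow> 'k poly"
  let ?rhs = "\<Sum>u\<in>P. ?L u * h_poly (princ_filter P u)"
  have low: "lower_graded P" using P by (simp add: eulerian_def)
  have finP: "finite P" using d by (simp add: graded_of_rank_def)
  have Q: "eulerian Q"
    using sub by (intro eulerian_if_locally_Eulerian) (auto simp: formal_subdivision_def)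
  have img: "\<sigma> ` Q = P" using sub by (simp add: formal_subdivision_def)
  \<comment> \<open>Finiteness of \<open>Q\<close>: it is covered by the finite sets Q_u over the
    finite poset \<open>P\<close>.\<close>
  have "Q = (\<Union>u\<in>P. sub_below P Q \<sigma> u)"
    using img by (fastforce simp: sub_below_def princ_ideal_def)
  also have "finite \<dots>" using sub finP by (auto simp: formal_subdivision_def)
  finally have finQ: "finite Q" .
  have rkP: "rk P u \<le> d" if "u \<in> P" for u using graded_rank_eq[OF d that] by simp
  have rkQ: "rk Q t \<le> d" if "t \<in> Q" for t
  proof -
    have "rk Q t \<le> rk P (\<sigma> t)" using sub that by (auto simp: formal_subdivision_def)
    moreover have "\<sigma> t \<in> P" using img that by blast
    ultimately show ?thesis using rkP order_trans by blast
  qed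
  have L: "degree (?L u) \<le> rk P u" "reflect_to (rk P u) (?L u) = ?L u" if "u \<in> P" for u
    using xi_coeff_symmetric[OF P subdivision_h_poly(1)[OF low sub] subdivision_h_acceptable[OF low sub] that]
    by blast+
  show ?thesis
  proof (cases "P = {}")
    \<comment> \<open>An empty \<open>P\<close> has no maximal element from which to read off the
      length of \<open>Q\<close>; here both sides are 0.\<close>
    case True
    then have "Q = {}" using img by simp
    then have "reflect_to 0 (h_part 0 Q {} :: 'k poly) = 0" "degree (h_part 0 Q {} :: 'k poly) \<le> 0"
      using h_part_reflect[OF Q, of "{}" 0, where ?'k = 'k] by simp_all
    then have "(h_part 0 Q {} :: 'k poly) = 0"
      using reflect_to_involution[of "h_part 0 Q {} :: 'k poly" 0] by simp
    moreover have "poset_length Q = 0"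
      using \<open>Q = {}\<close> poset_length_le[of Q 0] by (simp add: less_chain_iff)
    ultimately show ?thesis using True \<open>Q = {}\<close> by (simp add: h_poly_def)
  next
    case False
    have hQ: "(h_poly Q :: 'k poly) = h_part d Q Q"
      by (simp add: h_poly_def poset_length_subdivision[OF sub d False finQ])
    have "reflect_to d (h_poly Q :: 'k poly) = (\<Sum>t\<in>Q. gam Q (lam Q) t * [:-1, 1:] ^ (d - rk Q t))"
      unfolding hQ by (rule h_part_reflect(2)[OF Q order_refl finQ rkQ])
    also have "\<dots> = (\<Sum>t | t \<in> Q \<and> \<sigma> t \<in> P. gam Q (lam Q) t * [:-1, 1:] ^ (d - rk Q t))"
      using img by (intro sum.cong) auto
    also have "\<dots> = (\<Sum>u\<in>P. ?f u * [:-1, 1:] ^ (d - rk P u))"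
      using finQ finP rkP by (intro subdivision_sum_by_carrier[OF low sub, symmetric]) auto
    also have "\<dots> = (\<Sum>u\<in>P. \<Sum>v\<in>princ_ideal P u. ?L v * (?x v u * [:-1, 1:] ^ (d - rk P u)))"
    proof (rule sum.cong[OF refl])
      fix u assume "u \<in> P"
      from xi_coeff_expansion[OF P this, of ?f]
      show "?f u * [:-1, 1:] ^ (d - rk P u) =
          (\<Sum>v\<in>princ_ideal P u. ?L v * (?x v u * [:-1, 1:] ^ (d - rk P u)))"
        by (simp only: sum_distrib_right mult.assoc)
    qed
    also have "\<dots> = (\<Sum>v\<in>P. \<Sum>u\<in>princ_filter P v. ?L v * (?x v u * [:-1, 1:] ^ (d - rk P u)))"
      unfolding princ_ideal_def princ_filter_def by (rule sum.swap_restrict[OF finP finP])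
    \<comment> \<open>The inner sum is the reflected h-polynomial of the filter at \<open>v\<close>;
      symmetry of \<open>?L v\<close> turns the product into a single reflection of degree
      \<open>d\<close>.\<close>
    also have "\<dots> = (\<Sum>v\<in>P. reflect_to d (?L v * h_poly (princ_filter P v)))"
    proof (rule sum.cong[OF refl])
      fix v assume v: "v \<in> P"
      have "reflect_to (rk P v + (d - rk P v)) (?L v * h_poly (princ_filter P v)) =
          reflect_to (rk P v) (?L v) * reflect_to (d - rk P v) (h_poly (princ_filter P v))"
        by (rule reflect_to_mult[OF L(1)[OF v] h_poly_princ_filter(1)[OF P d v]])
      also have "\<dots> = ?L v * (\<Sum>u\<in>princ_filter P v. ?x v u * [:-1, 1:] ^ (d - rk P u))"
        by (simp only: L(2)[OF v] h_poly_princ_filter(2)[OF P d v])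
      finally show "(\<Sum>u\<in>princ_filter P v. ?L v * (?x v u * [:-1, 1:] ^ (d - rk P u))) =
          reflect_to d (?L v * h_poly (princ_filter P v))"
        using rkP[OF v] by (simp only: sum_distrib_left le_add_diff_inverse)
    qed
    also have "\<dots> = reflect_to d ?rhs" by (rule reflect_to_sum[symmetric])
    finally have eq: "reflect_to d (h_poly Q) = reflect_to d ?rhs" .
    have "degree ?rhs \<le> d"
    proof (intro degree_sum_le finP)
      fix v assume v: "v \<in> P"
      have "degree (?L v * h_poly (princ_filter P v)) \<le>
          degree (?L v) + degree (h_poly (princ_filter P v) :: 'k poly)" by (rule degree_mult_le)
      then show "degree (?L v * h_poly (princ_filter P v)) \<le> d"
        using L(1)[OF v] h_poly_princ_filter(1)[OF P d v, where ?'k = 'k] rkP[OF v] by linarith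
    qed
    moreover have "degree (h_poly Q :: 'k poly) \<le> d"
      unfolding hQ by (rule h_part_reflect(1)[OF Q order_refl finQ rkQ])
    ultimately show ?thesis
      using arg_cong[OF eq, of "reflect_to d"] by (simp only: reflect_to_involution)
  qed
qed

theorem theorem7p7:
  fixes P :: "'p::order set" and Q :: "'q::order set" and \<sigma> :: "'q \<Rightarrow> 'p"
  assumes "lower_graded P" and "locally_Eulerian P"
    and "formal_subdivision TYPE('k::field) P Q \<sigma>"
  shows "acceptable P (lam P) (\<lambda>u. h_poly (sub_below P Q \<sigma> u) :: 'k poly)
    \<and> (\<forall>m. maximum_elt P m \<longrightarrow>
         bar (rk P m) (local_h P Q \<sigma> :: 'k poly) = to_fract (local_h P Q \<sigma>))
    \<and> (\<forall>d. graded_of_rank P d \<longrightarrow>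
         (h_poly Q :: 'k poly) =
           (\<Sum>u\<in>P. local_h (princ_ideal P u) (sub_below P Q \<sigma> u) \<sigma> * h_poly (princ_filter P u)))"
proof (intro conjI allI impI)
  have P: "eulerian P" using assms(1,2) by (rule eulerian_if_locally_Eulerian)
  let ?f = "\<lambda>u. h_poly (sub_below P Q \<sigma> u) :: 'k poly"
  have deg: "degree (?f u) \<le> rk P u" if "u \<in> P" for u
    by (rule subdivision_h_poly(1)[OF assms(1,3) that])
  have acc: "reflect_to (rk P u) (?f u) = (\<Sum>v\<in>princ_ideal P u. ?f v * [:-1, 1:] ^ rk_int P v u)"
    if "u \<in> P" for u
    by (rule subdivision_h_acceptable[OF assms(1,3) that])
  show "acceptable P (lam P) ?f"
    using acc by (subst acceptable_lam_iff[OF deg]) auto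
  show "bar (rk P m) (local_h P Q \<sigma> :: 'k poly) = to_fract (local_h P Q \<sigma>)" if m: "maximum_elt P m" for m
  proof -
    \<comment> \<open>With a maximum, \<open>P\<close> and \<open>Q\<close> are the principal ideal
      of \<open>m\<close> and its preimage, so part (b) is an instance of the symmetry of
      \<open>xi_coeff\<close>.\<close>
    have "m \<in> P" "princ_ideal P m = P" using m by (auto simp: maximum_elt_def princ_ideal_def)
    moreover have "sub_below P Q \<sigma> m = Q"
      using assms(3) \<open>princ_ideal P m = P\<close> by (auto simp: formal_subdivision_def sub_below_def)
    ultimately have "(local_h P Q \<sigma> :: 'k poly) = xi_coeff P ?f m"
      using local_h_princ_ideal[OF P, of m Q \<sigma>] by simp
    then show ?thesis
      using xi_coeff_symmetric[OF P deg acc \<open>m \<in> P\<close>] by (simp add: bar_eq_reflect_to)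
  qed
  show "(h_poly Q :: 'k poly) =
      (\<Sum>u\<in>P. local_h (princ_ideal P u) (sub_below P Q \<sigma> u) \<sigma> * h_poly (princ_filter P u))"
    if "graded_of_rank P d" for d
    unfolding subdivision_h_poly_decomposition[OF P assms(3) that]
    by (intro sum.cong) (simp_all add: local_h_princ_ideal[OF P])
qed

end
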